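(* Let $\mu$ be a pairwise-connected distribution on $\Sigma\times\Gamma\times\Phi$ (finite sets) and let $T:\mathsf{supp}(\mu)\to\mathbb{D}$ be nonembeddable over $\mathbb{D}$. Then there is a constant $c=c(T,\mu)>0$ such that for all $n$ and all functions $F:\Sigma^n\to\mathbb{D}$, $G:\Gamma^n\to\mathbb{D}$, $H:\Phi^n\to\mathbb{D}$, $$\left|\mathbb{E}_{(x,y,z)\sim\mu^{\otimes n}}\Big[F(x)G(y)H(z)\prod_{i=1}^nT(x_i,y_i,z_i)\Big]\right|\le 2^{-cn}.$$
   Context: $\mathbb{D}$ is the closed unit disk in $\mathbb{C}$. $T$ is nonembeddable over $\mathbb{D}$ if there are no functions $A:\Sigma\to\mathbb{D}$, $B:\Gamma\to\mathbb{D}$, $C:\Phi\to\mathbb{D}$ with $A(x)B(y)C(z)T(x,y,z)=1$ for all $(x,y,z)\in\mathsf{supp}(\mu)$. $\mu$ is pairwise-connected if each of the three bipartite graphs (on $\Sigma\sqcup\Gamma$, $\Gamma\sqcup\Phi$, $\Sigma\sqcup\Phi$), where two symbols from different coordinates are adjacent iff they appear together in some triple of $\mathsf{supp}(\mu)$, is connected. *)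

theory Defs
  imports Complex_Main
begin

definition is_distribution :: "('t::finite \<Rightarrow> real) \<Rightarrow> bool" where
  "is_distribution \<mu> \<longleftrightarrow> (\<forall>t. \<mu> t \<ge> 0) \<and> sum \<mu> UNIV = 1"

definition supp :: "('t \<Rightarrow> real) \<Rightarrow> 't set" where
  "supp \<mu> = {t. \<mu> t > 0}"

definition bip_adj :: "('a \<Rightarrow> 'b \<Rightarrow> bool) \<Rightarrow> 'a + 'b \<Rightarrow> 'a + 'b \<Rightarrow> bool" where
  "bip_adj E p q = (case (p, q) of
      (Inl x, Inr y) \<Rightarrow> E x y
    | (Inr y, Inl x) \<Rightarrow> E x y
    | _ \<Rightarrow> False)"

definition bip_connected :: "('a \<Rightarrow> 'b \<Rightarrow> bool) \<Rightarrow> bool" where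
  "bip_connected E \<longleftrightarrow> (\<forall>u v. (bip_adj E)\<^sup>*\<^sup>* u v)"

definition pairwise_connected :: "('a \<times> 'b \<times> 'c \<Rightarrow> real) \<Rightarrow> bool" where
  "pairwise_connected \<mu> \<longleftrightarrow>
     bip_connected (\<lambda>x y. \<exists>z. (x, y, z) \<in> supp \<mu>) \<and>
     bip_connected (\<lambda>y z. \<exists>x. (x, y, z) \<in> supp \<mu>) \<and>
     bip_connected (\<lambda>x z. \<exists>y. (x, y, z) \<in> supp \<mu>)"

definition nonembeddable_disk ::
  "('a \<times> 'b \<times> 'c \<Rightarrow> real) \<Rightarrow> ('a \<Rightarrow> 'b \<Rightarrow> 'c \<Rightarrow> complex) \<Rightarrow> bool" where
  "nonembeddable_disk \<mu> T \<longleftrightarrow>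
     \<not> (\<exists>A B C. (\<forall>x. norm (A x) \<le> 1) \<and> (\<forall>y. norm (B y) \<le> 1) \<and> (\<forall>z. norm (C z) \<le> 1) \<and>
          (\<forall>x y z. (x, y, z) \<in> supp \<mu> \<longrightarrow> A x * B y * C z * T x y z = 1))"

definition corr ::
  "('a::finite \<times> 'b::finite \<times> 'c::finite \<Rightarrow> real) \<Rightarrow> ('a \<Rightarrow> 'b \<Rightarrow> 'c \<Rightarrow> complex) \<Rightarrow> nat \<Rightarrow>
   ('a list \<Rightarrow> complex) \<Rightarrow> ('b list \<Rightarrow> complex) \<Rightarrow> ('c list \<Rightarrow> complex) \<Rightarrow> complex" where
  "corr \<mu> T n F G H =
     (\<Sum>w\<in>{w. length w = n}.
        complex_of_real (\<Prod>t\<leftarrow>w. \<mu> t) *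
        (F (map fst w) * G (map (fst \<circ> snd) w) * H (map (snd \<circ> snd) w) *
         (\<Prod>(x, y, z)\<leftarrow>w. T x y z)))"

end

theory Submission
  imports Defs "HOL-Analysis.Convex" "HOL-Library.Multiset" "HOL-Library.Nat_Bijection"
begin

text \<open>
  Nothing is to be done if \<open>T\<close> is not unimodular on the support. Otherwise the correlation is
  repeatedly squared by Cauchy--Schwarz: fixing some coordinates removes the functions of these
  coordinates and doubles all others, and the average over one coordinate position of what is left
  is multiplicative in \<open>n\<close>. So it suffices to reach an expression in which two configurations of
  positive weight agree in everything visible to the functions but carry different products of
  values of \<open>T\<close>.

  The \<^emph>\<open>path trick\<close> replaces \<open>x\<close> by a triple of labels along a path
  \<open>y - z - y - z\<close>; it preserves nonembeddability, because constant triples restrict to the original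
  game, and it enlarges the set of adjacent pairs \<open>(y, z)\<close>. By pairwise connectivity one reaches a
  game in which some \<open>o\<close> is adjacent to every \<open>z\<close> and all pairs \<open>(x, z)\<close> are adjacent.

  Since the unit circle is divisible, nonembeddability yields an integer combination of triples with
  vanishing marginals on which \<open>T\<close> is not 1. As the graph of the pairs \<open>(x, y)\<close> is connected, the
  combination can be realised by a closed walk \<open>o = y, x, y', x', \<dots>, o\<close> whose edges are labelled by
  symbols \<open>z\<close>: the words read (on the steps from \<open>y\<close> to \<open>x\<close>) and written (on the steps from \<open>x\<close> to
  \<open>y\<close>) are permutations of each other, and its phase is not 1. A walker staying at \<open>o\<close> copies any word,
  and by going back and forth once it transposes two adjacent letters; both have phase 1. Hence a
  sequence of such walks leads from the written word back to the word that was read, with total phase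
  different from 1, although the walker and the word have returned to their initial state.
\<close>

section \<open>Finite tuples and gluing by Cauchy--Schwarz\<close>

definition tup :: "nat \<Rightarrow> 'i set \<Rightarrow> 'i list set" where
  "tup n J = {l. set l \<subseteq> J \<and> length l = n}"

abbreviation lprod :: "('i \<Rightarrow> 'm::monoid_mult) \<Rightarrow> 'i list \<Rightarrow> 'm" where
  "lprod f l \<equiv> prod_list (map f l)"

definition marg :: "'i set \<Rightarrow> ('i \<Rightarrow> real) \<Rightarrow> ('i \<Rightarrow> 'u) \<Rightarrow> 'u \<Rightarrow> real" where
  "marg J P U u = sum P {j \<in> J. U j = u}"

text \<open>Strict positivity is built in: a configuration that is exhibited in an index set
  automatically occurs with positive probability.\<close>

definition prob_on :: "'i set \<Rightarrow> ('i \<Rightarrow> real) \<Rightarrow> bool" where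
  "prob_on J P \<longleftrightarrow> finite J \<and> (\<forall>j\<in>J. P j > 0) \<and> sum P J = 1"

definition glue_set :: "'i set \<Rightarrow> ('i \<Rightarrow> 'u) \<Rightarrow> ('i \<times> 'i) set" where
  "glue_set J U = {(i, j). i \<in> J \<and> j \<in> J \<and> U i = U j}"

text \<open>The law of two samples from \<open>P\<close> that are conditionally independent given
  their common value of \<open>U\<close>.\<close>

definition glue_wt :: "'i set \<Rightarrow> ('i \<Rightarrow> real) \<Rightarrow> ('i \<Rightarrow> 'u) \<Rightarrow> 'i \<times> 'i \<Rightarrow> real" where
  "glue_wt J P U = (\<lambda>(i, j). P i * P j / marg J P U (U i))"

lemma finite_tup [simp]: "finite J \<Longrightarrow> finite (tup n J)"
  unfolding tup_def by (simp add: finite_lists_length_eq)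

lemma tup_0 [simp]: "tup 0 J = {[]}"
  by (auto simp: tup_def)

lemma tup_Suc: "tup (Suc n) J = (\<lambda>(j, l). j # l) ` (J \<times> tup n J)"
  by (auto simp: tup_def length_Suc_conv image_iff)

lemma sum_tup_Suc: "sum f (tup (Suc n) J) = (\<Sum>j\<in>J. \<Sum>l\<in>tup n J. f (j # l))"
proof -
  have "inj_on (\<lambda>(j, l). j # l) (J \<times> tup n J)"
    by (auto simp: inj_on_def)
  then have "sum f (tup (Suc n) J) = (\<Sum>(j, l)\<in>J \<times> tup n J. f (j # l))"
    unfolding tup_Suc by (subst sum.reindex) (auto simp: case_prod_unfold)
  then show ?thesis by (simp add: sum.cartesian_product)
qed

text \<open>The source of exponential decay: once only products over coordinates are left, the value
  for one coordinate is raised to the power \<open>n\<close>.\<close>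

lemma sum_tup_lprod:
  fixes g :: "'i \<Rightarrow> 'm::comm_semiring_1"
  shows "(\<Sum>l\<in>tup n J. lprod g l) = (sum g J) ^ n"
  by (induction n) (simp_all add: sum_tup_Suc sum_distrib_left [symmetric] sum_distrib_right)

lemma tup_image: "tup n (f ` J) = map f ` tup n J"
proof
  show "map f ` tup n J \<subseteq> tup n (f ` J)" by (auto simp: tup_def subset_iff)
  show "tup n (f ` J) \<subseteq> map f ` tup n J"
  proof
    fix l assume "l \<in> tup n (f ` J)"
    then have "l \<in> lists (f ` J)" "length l = n" by (auto simp: tup_def)
    then obtain l' where "l' \<in> lists J" "l = map f l'"
      by (metis lists_image imageE)
    with \<open>length l = n\<close> show "l \<in> map f ` tup n J" by (auto simp: tup_def image_iff)
  qed
qed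

lemma sum_tup_image:
  assumes "inj_on f J"
  shows "sum h (tup n (f ` J)) = (\<Sum>l\<in>tup n J. h (map f l))"
proof -
  have "inj_on (map f) (tup n J)"
    using assms by (intro inj_onI) (auto simp: tup_def intro: map_inj_on inj_on_subset[OF assms])
  then show ?thesis unfolding tup_image by (simp add: sum.reindex)
qed

lemma sum_tup_bij:
  assumes "bij_betw f J K"
  shows "sum h (tup n K) = (\<Sum>l\<in>tup n J. h (map f l))"
  using assms sum_tup_image[of f J h n] by (auto simp: bij_betw_def)

lemma prob_on_tup:
  assumes "prob_on J P"
  shows "prob_on (tup n J) (lprod P)"
  unfolding prob_on_def
proof (intro conjI ballI)
  show "finite (tup n J)" using assms by (auto simp: prob_on_def)
  show "sum (lprod P) (tup n J) = 1" using assms by (simp add: sum_tup_lprod prob_on_def)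
  show "lprod P l > 0" if "l \<in> tup n J" for l
    using that assms
    by (induction l arbitrary: n) (auto simp: tup_def prob_on_def)
qed

text \<open>Conditional laws of tuples therefore factor over the coordinates, so that a gluing of
  tuples can be read as a tuple of gluings.\<close>

lemma marg_tup:
  assumes "finite J" "length us = n"
  shows "marg (tup n J) (lprod P) (map U) us = lprod (marg J P U) us"
  using assms(2)
proof (induction us arbitrary: n)
  case Nil
  then show ?case by (simp add: marg_def)
next
  case (Cons u us)
  then obtain m where m: "n = Suc m" "length us = m" by auto
  have eq: "marg (tup n J) (lprod P) (map U) (u # us)
      = (\<Sum>l\<in>tup n J. if map U l = u # us then lprod P l else 0)"
    using assms(1) by (simp add: marg_def sum.inter_filter)
  also have "\<dots> = (\<Sum>j\<in>J. \<Sum>l\<in>tup m J. (if U j = u then P j else 0) * (if map U l = us then lprod P l else 0))"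
    unfolding m by (simp add: sum_tup_Suc) (intro sum.cong refl, auto)
  also have "\<dots> = (\<Sum>j\<in>J. if U j = u then P j else 0) * (\<Sum>l\<in>tup m J. if map U l = us then lprod P l else 0)"
    by (simp add: sum_product)
  also have "\<dots> = marg J P U u * marg (tup m J) (lprod P) (map U) us"
    using assms(1) by (simp add: marg_def sum.inter_filter)
  finally show ?case using Cons.IH[OF m(2)] by simp
qed

section \<open>Gluing two copies of a space along a common view\<close>

lemma marg_pos:
  assumes "prob_on J P" "j \<in> J"
  shows "marg J P U (U j) > 0"
  unfolding marg_def using assms by (intro sum_pos) (auto simp: prob_on_def)

lemma marg_ge:
  assumes "prob_on J P"
  shows "marg J P U u \<ge> 0"
  unfolding marg_def using assms by (intro sum_nonneg) (auto simp: prob_on_def intro: less_imp_le)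

lemma sum_fibers:
  assumes "finite J"
  shows "sum f J = (\<Sum>u\<in>U ` J. \<Sum>j\<in>{j\<in>J. U j = u}. f j)"
  using sum.image_gen[OF assms, of f U] by simp

text \<open>Grouping the sum by the value \<open>u\<close> of \<open>U\<close> takes
  \<open>\<Phi> u\<close> out of each fibre, where its bound discards it. Cauchy--Schwarz over the
  fibres leaves squared norms of fibre sums, that is, sums over pairs with equal
  \<open>U\<close>.\<close>

lemma glue_single:
  fixes \<Psi> :: "'i \<Rightarrow> complex"
  assumes P: "prob_on J P" and \<Phi>: "\<And>u. norm (\<Phi> u) \<le> 1"
  shows "norm (\<Sum>j\<in>J. of_real (P j) * \<Phi> (U j) * \<Psi> j) ^ 2
     \<le> norm (\<Sum>i\<in>J. \<Sum>j\<in>{j\<in>J. U j = U i}. of_real (P i * P j / marg J P U (U i)) * (\<Psi> i * cnj (\<Psi> j)))"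
proof -
  have fin: "finite J" using P by (simp add: prob_on_def)
  define S where "S u = (\<Sum>j\<in>{j\<in>J. U j = u}. of_real (P j) * \<Psi> j)" for u
  define m where "m = marg J P U"
  have mpos: "m u > 0" if "u \<in> U ` J" for u
    using that marg_pos[OF P] by (auto simp: m_def)
  have msum: "sum m (U ` J) = 1"
    unfolding m_def marg_def using sum_fibers[OF fin, of P U] P by (simp add: prob_on_def)
  have "(\<Sum>j\<in>J. of_real (P j) * \<Phi> (U j) * \<Psi> j) = (\<Sum>u\<in>U ` J. \<Phi> u * S u)"
    unfolding S_def sum_distrib_left
    by (subst sum_fibers[OF fin, of _ U]) (auto intro!: sum.cong)
  then have "norm (\<Sum>j\<in>J. of_real (P j) * \<Phi> (U j) * \<Psi> j) \<le> (\<Sum>u\<in>U ` J. norm (\<Phi> u * S u))"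
    by (simp add: norm_sum)
  also have "\<dots> \<le> (\<Sum>u\<in>U ` J. norm (S u))"
    by (intro sum_mono) (simp add: norm_mult mult_left_le_one_le \<Phi>)
  \<comment> \<open>With \<open>sqrt (m u)\<close> split off, the first factor of Cauchy--Schwarz
    sums to 1.\<close>
  also have "\<dots> = (\<Sum>u\<in>U ` J. sqrt (m u) * (norm (S u) / sqrt (m u)))"
    using mpos by (intro sum.cong) (auto simp: less_imp_le dest!: mpos)
  finally have "norm (\<Sum>j\<in>J. of_real (P j) * \<Phi> (U j) * \<Psi> j) ^ 2
      \<le> (\<Sum>u\<in>U ` J. sqrt (m u) * (norm (S u) / sqrt (m u))) ^ 2"
    by (intro power_mono) auto
  also have "\<dots> \<le> (\<Sum>u\<in>U ` J. (sqrt (m u))\<^sup>2) * (\<Sum>u\<in>U ` J. (norm (S u) / sqrt (m u))\<^sup>2)"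
    by (rule Cauchy_Schwarz_ineq_sum)
  also have "(\<Sum>u\<in>U ` J. (sqrt (m u))\<^sup>2) = 1"
    using msum mpos by (metis (no_types, lifting) less_imp_le real_sqrt_pow2 sum.cong)
  also have "1 * (\<Sum>u\<in>U ` J. (norm (S u) / sqrt (m u))\<^sup>2) = (\<Sum>u\<in>U ` J. (norm (S u))\<^sup>2 / m u)"
    using mpos by (simp add: power_divide less_imp_le)
  also have "\<dots> \<le> norm (complex_of_real (\<Sum>u\<in>U ` J. (norm (S u))\<^sup>2 / m u))"
    by (metis abs_ge_self norm_of_real)
  also have "complex_of_real (\<Sum>u\<in>U ` J. (norm (S u))\<^sup>2 / m u) = (\<Sum>u\<in>U ` J. S u * cnj (S u) / of_real (m u))"
    by (simp flip: complex_norm_square)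
  also have "\<dots> = (\<Sum>u\<in>U ` J. \<Sum>i\<in>{j\<in>J. U j = u}. \<Sum>j\<in>{j\<in>J. U j = U i}.
       of_real (P i * P j / m (U i)) * (\<Psi> i * cnj (\<Psi> j)))"
  proof (intro sum.cong refl)
    fix u
    have "S u * cnj (S u) / of_real (m u)
      = (\<Sum>i\<in>{j\<in>J. U j = u}. \<Sum>j\<in>{j\<in>J. U j = u}. of_real (P i * P j / m u) * (\<Psi> i * cnj (\<Psi> j)))"
      unfolding S_def cnj_sum sum_product sum_divide_distrib
      by (intro sum.cong refl) (simp add: field_simps)
    then show "S u * cnj (S u) / of_real (m u) = (\<Sum>i\<in>{j\<in>J. U j = u}. \<Sum>j\<in>{j\<in>J. U j = U i}.
       of_real (P i * P j / m (U i)) * (\<Psi> i * cnj (\<Psi> j)))" by (auto intro!: sum.cong)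
  qed
  also have "\<dots> = (\<Sum>i\<in>J. \<Sum>j\<in>{j\<in>J. U j = U i}. of_real (P i * P j / m (U i)) * (\<Psi> i * cnj (\<Psi> j)))"
    by (rule sum_fibers[OF fin, symmetric])
  finally show ?thesis unfolding m_def .
qed

lemma lprod_mult:
  fixes f g :: "'i \<Rightarrow> 'm::comm_monoid_mult"
  shows "lprod (\<lambda>i. f i * g i) l = lprod f l * lprod g l"
  by (induction l) (simp_all add: ac_simps)

lemma lprod_divide:
  fixes f g :: "'i \<Rightarrow> 'm::field"
  shows "lprod (\<lambda>i. f i / g i) l = lprod f l / lprod g l"
  by (induction l) simp_all

lemma of_real_lprod: "of_real (lprod f l) = lprod (\<lambda>i. of_real (f i) :: complex) l"
  by (induction l) simp_all

lemma cnj_lprod: "cnj (lprod f l) = lprod (\<lambda>i. cnj (f i)) l"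
  by (induction l) simp_all

lemma norm_lprod: "norm (lprod f l :: complex) = lprod (\<lambda>i. norm (f i)) l"
  by (induction l) (simp_all add: norm_mult)

lemma prob_on_glue:
  assumes "prob_on J P"
  shows "prob_on (glue_set J U) (glue_wt J P U)"
  unfolding prob_on_def
proof (intro conjI ballI)
  have fin: "finite J" using assms by (simp add: prob_on_def)
  have eq: "glue_set J U = Sigma J (\<lambda>i. {j\<in>J. U j = U i})"
    by (auto simp: glue_set_def)
  show "finite (glue_set J U)" unfolding eq using fin by auto
  show "glue_wt J P U x > 0" if "x \<in> glue_set J U" for x
    using that assms by (auto simp: glue_set_def glue_wt_def prob_on_def marg_pos[OF assms]
        intro!: divide_pos_pos mult_pos_pos)
  have "sum (glue_wt J P U) (glue_set J U) = (\<Sum>i\<in>J. \<Sum>j\<in>{j\<in>J. U j = U i}. P i * P j / marg J P U (U i))"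
    unfolding eq glue_wt_def using fin by (subst sum.Sigma) auto
  also have "\<dots> = (\<Sum>i\<in>J. P i * (marg J P U (U i)) / marg J P U (U i))"
    by (simp add: marg_def sum_distrib_left sum_divide_distrib)
  also have "\<dots> = sum P J"
    using marg_pos[OF assms, of _ U] by (intro sum.cong) (auto simp: less_le)
  finally show "sum (glue_wt J P U) (glue_set J U) = 1" using assms by (simp add: prob_on_def)
qed

text \<open>\<open>glue_single\<close> for the product measure. Zipping identifies two tuples that
  agree under \<open>map U\<close> with a tuple of glued pairs, and \<open>marg_tup\<close> matches
  the weights.\<close>

lemma glue_tup:
  fixes \<Psi> :: "'i list \<Rightarrow> complex"
  assumes P: "prob_on J P" and \<Phi>: "\<And>u. norm (\<Phi> u) \<le> 1"
  shows "norm (\<Sum>l\<in>tup n J. of_real (lprod P l) * \<Phi> (map U l) * \<Psi> l) ^ 2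
     \<le> norm (\<Sum>l\<in>tup n (glue_set J U).
            of_real (lprod (glue_wt J P U) l) * (\<Psi> (map fst l) * cnj (\<Psi> (map snd l))))"
proof -
  have fin: "finite J" using P by (simp add: prob_on_def)
  let ?f = "\<lambda>(l, l'). of_real (lprod P l * lprod P l' / marg (tup n J) (lprod P) (map U) (map U l))
       * (\<Psi> l * cnj (\<Psi> l'))"
  have "(\<Sum>l\<in>tup n J. \<Sum>l'\<in>{l'\<in>tup n J. map U l' = map U l}. ?f (l, l'))
      = sum ?f (Sigma (tup n J) (\<lambda>l. {l'\<in>tup n J. map U l' = map U l}))"
    using fin by (subst sum.Sigma) auto
  also have "\<dots> = (\<Sum>l\<in>tup n (glue_set J U).
            of_real (lprod (glue_wt J P U) l) * (\<Psi> (map fst l) * cnj (\<Psi> (map snd l))))"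
  proof (rule sum.reindex_bij_witness[where i = "\<lambda>l. (map fst l, map snd l)" and j = "\<lambda>(l, l'). zip l l'"])
    fix a assume a: "a \<in> Sigma (tup n J) (\<lambda>l. {l'\<in>tup n J. map U l' = map U l})"
    obtain l l' where ll: "a = (l, l')" "l \<in> tup n J" "l' \<in> tup n J" "map U l' = map U l" using a by auto
    have len: "length l = length l'" "length l = n" using ll by (auto simp: tup_def)
    show "(\<lambda>l. (map fst l, map snd l)) ((\<lambda>(l, l'). zip l l') a) = a" using ll len by simp
    show z: "(\<lambda>(l, l'). zip l l') a \<in> tup n (glue_set J U)"
    proof -
      have "p \<in> glue_set J U" if p: "p \<in> set (zip l l')" for p
      proof -
        obtain k where k: "k < length l" "p = (l ! k, l' ! k)" using p len by (auto simp: set_zip)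
        have "l ! k \<in> J" "l' ! k \<in> J" using k len ll by (auto simp: tup_def subset_iff)
        moreover have "U (l ! k) = U (l' ! k)" using ll(4) k len by (metis nth_map)
        ultimately show ?thesis using k by (simp add: glue_set_def)
      qed
      then show ?thesis using ll len by (auto simp: tup_def)
    qed
    have "lprod (glue_wt J P U) (zip l l')
        = lprod (\<lambda>x. P (fst x) * P (snd x) / marg J P U (U (fst x))) (zip l l')"
      by (simp add: glue_wt_def case_prod_unfold)
    also have "\<dots> = lprod P (map fst (zip l l')) * lprod P (map snd (zip l l'))
        / lprod (marg J P U) (map U (map fst (zip l l')))"
      by (simp only: lprod_divide lprod_mult map_map comp_def)
    also have "\<dots> = lprod P l * lprod P l' / lprod (marg J P U) (map U l)"
      using len by simp
    finally have "lprod (glue_wt J P U) (zip l l') = lprod P l * lprod P l' / lprod (marg J P U) (map U l)" .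
    moreover have "marg (tup n J) (lprod P) (map U) (map U l) = lprod (marg J P U) (map U l)"
      by (rule marg_tup[OF fin]) (use len in simp)
    ultimately show "of_real (lprod (glue_wt J P U) ((\<lambda>(l, l'). zip l l') a)) * (\<Psi> (map fst ((\<lambda>(l, l'). zip l l') a))
         * cnj (\<Psi> (map snd ((\<lambda>(l, l'). zip l l') a)))) = ?f a"
      using ll(1) len by simp
  next
    fix l assume l: "l \<in> tup n (glue_set J U)"
    show "(\<lambda>(l, l'). zip l l') (map fst l, map snd l) = l" by (simp add: zip_map_fst_snd)
    show "(map fst l, map snd l) \<in> Sigma (tup n J) (\<lambda>l. {l'\<in>tup n J. map U l' = map U l})"
      using l by (fastforce simp: tup_def glue_set_def)
  qed
  finally show ?thesis
    using glue_single[OF prob_on_tup[OF P, of n], of \<Phi> "map U" \<Psi>] \<Phi> by simp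
qed

section \<open>Correlations and the path trick\<close>

definition bounded1 :: "('a \<Rightarrow> complex) \<Rightarrow> bool" where
  "bounded1 F \<longleftrightarrow> (\<forall>x. norm (F x) \<le> 1)"

text \<open>The maps \<open>X\<close>, \<open>Y\<close>, \<open>Z\<close> need not determine the index: whatever they do not see is
  averaged out.\<close>

definition gcorr :: "'i set \<Rightarrow> ('i \<Rightarrow> real) \<Rightarrow> ('i \<Rightarrow> complex) \<Rightarrow> ('i \<Rightarrow> 'x) \<Rightarrow> ('i \<Rightarrow> 'y) \<Rightarrow> ('i \<Rightarrow> 'z) \<Rightarrow>
    nat \<Rightarrow> ('x list \<Rightarrow> complex) \<Rightarrow> ('y list \<Rightarrow> complex) \<Rightarrow> ('z list \<Rightarrow> complex) \<Rightarrow> complex" where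
  "gcorr I P \<theta> X Y Z n F G H =
     (\<Sum>l\<in>tup n I. of_real (lprod P l) * (lprod \<theta> l * F (map X l) * G (map Y l) * H (map Z l)))"

text \<open>The bound is uniform in the three functions. The power \<open>M\<close> absorbs the
  squarings caused by Cauchy--Schwarz; since it is positive, a root can be taken at the very
  end.\<close>

definition decay :: "'i set \<Rightarrow> ('i \<Rightarrow> real) \<Rightarrow> ('i \<Rightarrow> complex) \<Rightarrow> ('i \<Rightarrow> 'x) \<Rightarrow> ('i \<Rightarrow> 'y) \<Rightarrow> ('i \<Rightarrow> 'z) \<Rightarrow> bool" where
  "decay I P \<theta> X Y Z \<longleftrightarrow> (\<exists>\<rho> M. 0 \<le> \<rho> \<and> \<rho> < 1 \<and> M > (0::nat) \<and>
     (\<forall>n F G H. bounded1 F \<longrightarrow> bounded1 G \<longrightarrow> bounded1 H \<longrightarrow> norm (gcorr I P \<theta> X Y Z n F G H) ^ M \<le> \<rho> ^ n))"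

lemma decay_swap: "decay I P \<theta> Y X Z \<Longrightarrow> decay I P \<theta> X Y Z"
proof -
  have "gcorr I P \<theta> X Y Z n F G H = gcorr I P \<theta> Y X Z n G F H" for n F G H
    unfolding gcorr_def by (intro sum.cong refl) (simp add: ac_simps)
  then show "decay I P \<theta> Y X Z \<Longrightarrow> decay I P \<theta> X Y Z" unfolding decay_def by metis
qed

text \<open>Precomposition with the inverses of \<open>a\<close>, \<open>b\<close> and
  \<open>c\<close> turns the given functions into functions of the recoded labels with the same
  correlation. This allows all indices and labels to be coded by natural numbers.\<close>

lemma decay_relabel:
  fixes X :: "'i \<Rightarrow> 'x" and Y :: "'i \<Rightarrow> 'y" and Z :: "'i \<Rightarrow> 'z"
  assumes f: "bij_betw f J I"
    and eq: "\<And>j. j \<in> J \<Longrightarrow> P (f j) = P' j \<and> \<theta> (f j) = \<theta>' j \<and> X (f j) = a (X' j) \<and> Y (f j) = b (Y' j) \<and> Z (f j) = c (Z' j)"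
    and inj: "inj a" "inj b" "inj c"
    and D: "decay I P \<theta> X Y Z"
  shows "decay J P' \<theta>' X' Y' Z'"
proof -
  obtain \<rho> M where \<rho>: "0 \<le> \<rho>" "\<rho> < 1" "M > (0::nat)" and
    B: "\<And>n F G H. bounded1 F \<Longrightarrow> bounded1 G \<Longrightarrow> bounded1 H \<Longrightarrow> norm (gcorr I P \<theta> X Y Z n F G H) ^ M \<le> \<rho> ^ n"
    using D unfolding decay_def by blast
  have "norm (gcorr J P' \<theta>' X' Y' Z' n F G H) ^ M \<le> \<rho> ^ n" if bd: "bounded1 F" "bounded1 G" "bounded1 H" for n F G H
  proof -
    let ?F = "\<lambda>xs. F (map (inv a) xs)" and ?G = "\<lambda>xs. G (map (inv b) xs)" and ?H = "\<lambda>xs. H (map (inv c) xs)"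
    have "gcorr I P \<theta> X Y Z n ?F ?G ?H = gcorr J P' \<theta>' X' Y' Z' n F G H"
      unfolding gcorr_def sum_tup_bij[OF f]
    proof (intro sum.cong refl)
      fix l assume l: "l \<in> tup n J"
      then have lJ: "\<And>j. j \<in> set l \<Longrightarrow> j \<in> J" by (auto simp: tup_def)
      have "map P (map f l) = map P' l" "map \<theta> (map f l) = map \<theta>' l"
        "map (inv a) (map X (map f l)) = map X' l" "map (inv b) (map Y (map f l)) = map Y' l"
        "map (inv c) (map Z (map f l)) = map Z' l"
        using lJ eq inj by (auto simp: inv_f_f)
      then show "of_real (lprod P (map f l)) * (lprod \<theta> (map f l) * ?F (map X (map f l)) * ?G (map Y (map f l)) * ?H (map Z (map f l)))
        = of_real (lprod P' l) * (lprod \<theta>' l * F (map X' l) * G (map Y' l) * H (map Z' l))" by (simp only:)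
    qed
    then show ?thesis using B[of ?F ?G ?H n] bd by (simp add: bounded1_def)
  qed
  then show ?thesis unfolding decay_def using \<rho> by blast
qed

section \<open>The path trick\<close>

definition path_set :: "'i set \<Rightarrow> ('i \<Rightarrow> 'y) \<Rightarrow> ('i \<Rightarrow> 'z) \<Rightarrow> ('i \<times> 'i \<times> 'i) set" where
  "path_set I Y Z = {(i, j, k). i \<in> I \<and> j \<in> I \<and> k \<in> I \<and> Z i = Z j \<and> Y j = Y k}"

text \<open>The law of a random path with edges \<open>i\<close>, \<open>j\<close>,
  \<open>k\<close>: \<open>i\<close> has law \<open>P\<close>, then \<open>j\<close> is chosen given
  its \<open>Z\<close>-value and \<open>k\<close> given its \<open>Y\<close>-value.\<close>

definition path_wt :: "'i set \<Rightarrow> ('i \<Rightarrow> real) \<Rightarrow> ('i \<Rightarrow> 'y) \<Rightarrow> ('i \<Rightarrow> 'z) \<Rightarrow> 'i \<times> 'i \<times> 'i \<Rightarrow> real" where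
  "path_wt I P Y Z = (\<lambda>(i, j, k). P i * P j * P k / (marg I P Z (Z i) * marg I P Y (Y j)))"

text \<open>The middle edge is conjugated, so a constant triple carries the original phase when that
  phase is unimodular.\<close>

definition path_ph :: "('i \<Rightarrow> complex) \<Rightarrow> 'i \<times> 'i \<times> 'i \<Rightarrow> complex" where
  "path_ph \<theta> = (\<lambda>(i, j, k). \<theta> i * cnj (\<theta> j) * \<theta> k)"

text \<open>Replacing \<open>G\<close> by the conjugate of its dual function \<open>D\<close> is what keeps a function of
  the first coordinate at one end of the path, so that the length of the path stays odd.\<close>

lemma path_single:
  fixes a :: "'i \<Rightarrow> complex"
  assumes P: "prob_on J P" and a: "\<And>j. j \<in> J \<Longrightarrow> norm (a j) \<le> 1" and GH: "bounded1 G" "bounded1 H"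
  obtains G' where "bounded1 G'" and
    "norm (\<Sum>j\<in>J. of_real (P j) * (a j * G (Y j) * H (Z j))) ^ 4
      \<le> norm (\<Sum>(i, j, k)\<in>path_set J Y Z. of_real (path_wt J P Y Z (i, j, k)) *
            (a i * cnj (a j) * a k * G' (Y i) * H (Z k)))"
proof -
  have fin: "finite J" using P by (simp add: prob_on_def)
  \<comment> \<open>The dual function: the conditional expectation, given the
    \<open>Y\<close>-value, of everything that multiplies \<open>G\<close>.\<close>
  define D where "D y = (\<Sum>j\<in>{j\<in>J. Y j = y}. of_real (P j / marg J P Y y) * (a j * H (Z j)))" for y
  have D1: "bounded1 (\<lambda>y. cnj (D y))"
    unfolding bounded1_def
  proof
    fix y
    have "norm (D y) \<le> (\<Sum>j\<in>{j\<in>J. Y j = y}. P j / marg J P Y y)"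
      unfolding D_def
    proof (rule sum_norm_le)
      fix j assume j: "j \<in> {j\<in>J. Y j = y}"
      have "norm (a j * H (Z j)) \<le> 1 * 1"
        unfolding norm_mult using a j GH by (intro mult_mono) (auto simp: bounded1_def)
      moreover have "P j / marg J P Y y \<ge> 0" using P j marg_ge[OF P, of Y y] by (simp add: prob_on_def less_imp_le)
      ultimately show "norm (of_real (P j / marg J P Y y) * (a j * H (Z j))) \<le> P j / marg J P Y y"
        unfolding norm_mult[of "of_real _"] norm_of_real by (simp only: abs_of_nonneg mult_left_le)
    qed
    also have "\<dots> = marg J P Y y / marg J P Y y" by (simp only: marg_def sum_divide_distrib)
    also have "\<dots> \<le> 1" by simp
    finally show "norm (cnj (D y)) \<le> 1" by simp
  qed
  let ?c = "\<Sum>j\<in>J. of_real (P j) * (a j * G (Y j) * H (Z j))"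
  let ?e = "\<Sum>j\<in>J. of_real (P j) * (a j * H (Z j) * cnj (D (Y j)))"
  have "?c = (\<Sum>j\<in>J. of_real (P j) * G (Y j) * (a j * H (Z j)))"
    by (intro sum.cong refl) (simp only: ac_simps)
  then have "norm ?c ^ 2 \<le> norm (\<Sum>i\<in>J. \<Sum>j\<in>{j\<in>J. Y j = Y i}. of_real (P i * P j / marg J P Y (Y i))
      * ((a i * H (Z i)) * cnj (a j * H (Z j))))"
    using glue_single[OF P, of G Y "\<lambda>j. a j * H (Z j)"] GH
    by (simp only: bounded1_def)
  also have "(\<Sum>i\<in>J. \<Sum>j\<in>{j\<in>J. Y j = Y i}. of_real (P i * P j / marg J P Y (Y i))
      * ((a i * H (Z i)) * cnj (a j * H (Z j)))) = ?e"
  proof (intro sum.cong refl)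
    fix i
    show "(\<Sum>j\<in>{j\<in>J. Y j = Y i}. of_real (P i * P j / marg J P Y (Y i))
      * ((a i * H (Z i)) * cnj (a j * H (Z j)))) = of_real (P i) * (a i * H (Z i) * cnj (D (Y i)))"
      unfolding D_def cnj_sum sum_distrib_left
      by (intro sum.cong refl) simp
  qed
  finally have 1: "norm ?c ^ 2 \<le> norm ?e" .
  have "?e = (\<Sum>j\<in>J. of_real (P j) * H (Z j) * (a j * cnj (D (Y j))))"
    by (intro sum.cong refl) (simp only: ac_simps)
  then have "norm ?e ^ 2 \<le> norm (\<Sum>i\<in>J. \<Sum>j\<in>{j\<in>J. Z j = Z i}. of_real (P i * P j / marg J P Z (Z i))
      * ((a i * cnj (D (Y i))) * cnj (a j * cnj (D (Y j)))))"
    using glue_single[OF P, of H Z "\<lambda>j. a j * cnj (D (Y j))"] GH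
    by (simp only: bounded1_def)
  also have "(\<Sum>i\<in>J. \<Sum>j\<in>{j\<in>J. Z j = Z i}. of_real (P i * P j / marg J P Z (Z i))
      * ((a i * cnj (D (Y i))) * cnj (a j * cnj (D (Y j)))))
    = (\<Sum>i\<in>J. \<Sum>j\<in>{j\<in>J. Z j = Z i}. \<Sum>k\<in>{k\<in>J. Y k = Y j}.
        of_real (path_wt J P Y Z (i, j, k)) * (a i * cnj (a j) * a k * cnj (D (Y i)) * H (Z k)))"
  proof (intro sum.cong refl)
    fix i j
    have "of_real (P i * P j / marg J P Z (Z i)) * ((a i * cnj (D (Y i))) * cnj (a j * cnj (D (Y j))))
      = of_real (P i * P j / marg J P Z (Z i)) * (a i * cnj (D (Y i)) * cnj (a j)) * D (Y j)"
      by simp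
    \<comment> \<open>Expanding the copy of \<open>D\<close> at \<open>j\<close> as an average
      creates the third edge \<open>k\<close>; the copy at \<open>i\<close> remains and becomes
      \<open>G'\<close>.\<close>
    also have "\<dots> = (\<Sum>k\<in>{k\<in>J. Y k = Y j}. of_real (P i * P j / marg J P Z (Z i)) * (a i * cnj (D (Y i)) * cnj (a j))
        * (of_real (P k / marg J P Y (Y j)) * (a k * H (Z k))))"
      by (simp only: D_def[of "Y j"] sum_distrib_left)
    also have "\<dots> = (\<Sum>k\<in>{k\<in>J. Y k = Y j}.
        of_real (path_wt J P Y Z (i, j, k)) * (a i * cnj (a j) * a k * cnj (D (Y i)) * H (Z k)))"
      by (intro sum.cong refl) (simp add: path_wt_def)
    finally show "of_real (P i * P j / marg J P Z (Z i)) * ((a i * cnj (D (Y i))) * cnj (a j * cnj (D (Y j))))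
      = (\<Sum>k\<in>{k\<in>J. Y k = Y j}.
        of_real (path_wt J P Y Z (i, j, k)) * (a i * cnj (a j) * a k * cnj (D (Y i)) * H (Z k)))" .
  qed
  also have "\<dots> = (\<Sum>(i, j, k)\<in>path_set J Y Z. of_real (path_wt J P Y Z (i, j, k)) *
            (a i * cnj (a j) * a k * cnj (D (Y i)) * H (Z k)))"
  proof -
    have "path_set J Y Z = Sigma J (\<lambda>i. Sigma {j\<in>J. Z j = Z i} (\<lambda>j. {k\<in>J. Y k = Y j}))"
      by (auto simp: path_set_def)
    then show ?thesis using fin by (simp add: sum.Sigma)
  qed
  finally have 2: "norm ?e ^ 2 \<le> norm (\<Sum>(i, j, k)\<in>path_set J Y Z. of_real (path_wt J P Y Z (i, j, k)) *
            (a i * cnj (a j) * a k * cnj (D (Y i)) * H (Z k)))" .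
  have "norm ?c ^ 4 = (norm ?c ^ 2) ^ 2" by (simp flip: power_mult)
  also have "\<dots> \<le> norm ?e ^ 2" using 1 by (intro power_mono) auto
  finally show ?thesis using that[OF D1] 2 by simp
qed

definition fst3 :: "'i \<times> 'i \<times> 'i \<Rightarrow> 'i" where "fst3 = (\<lambda>t. fst t)"
definition snd3 :: "'i \<times> 'i \<times> 'i \<Rightarrow> 'i" where "snd3 = (\<lambda>t. fst (snd t))"
definition trd3 :: "'i \<times> 'i \<times> 'i \<Rightarrow> 'i" where "trd3 = (\<lambda>t. snd (snd t))"

lemmas proj3 = fst3_def snd3_def trd3_def

definition map3 :: "('i \<Rightarrow> 'x) \<Rightarrow> 'i \<times> 'i \<times> 'i \<Rightarrow> 'x \<times> 'x \<times> 'x" where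
  "map3 f = (\<lambda>(i, j, k). (f i, f j, f k))"

text \<open>\<open>path_single\<close> for the product measure, with \<open>F\<close> absorbed into
  the coefficients \<open>a\<close>. The three copies of \<open>F\<close> that arise form one
  function \<open>F'\<close> of the triple of \<open>X\<close>-labels.\<close>

lemma path_tup:
  fixes \<theta> :: "'i \<Rightarrow> complex" and X :: "'i \<Rightarrow> 'x"
  assumes P: "prob_on I P" and th: "\<And>i. i \<in> I \<Longrightarrow> norm (\<theta> i) = 1"
    and F: "bounded1 F" and GH: "bounded1 G" "bounded1 H"
  obtains F' G' where "bounded1 F'" "bounded1 G'"
    "norm (gcorr I P \<theta> X Y Z n F G H) ^ 4 \<le>
     norm (gcorr (path_set I Y Z) (path_wt I P Y Z) (path_ph \<theta>) (map3 X) (Y \<circ> fst3) (Z \<circ> trd3) n F' G' H)"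
proof -
  have fin: "finite I" using P by (simp add: prob_on_def)
  let ?J = "tup n I"
  define a where "a l = lprod \<theta> l * F (map X l)" for l
  have a1: "norm (a l) \<le> 1" if "l \<in> ?J" for l
  proof -
    have "lprod (\<lambda>i. norm (\<theta> i)) l = 1" using that
      by (induction l arbitrary: n) (auto simp: tup_def th)
    then show ?thesis using F by (simp add: a_def norm_mult norm_lprod bounded1_def)
  qed
  obtain G' where G': "bounded1 G'" and le: "norm (\<Sum>l\<in>?J. of_real (lprod P l) * (a l * G (map Y l) * H (map Z l))) ^ 4
      \<le> norm (\<Sum>(i, j, k)\<in>path_set ?J (map Y) (map Z). of_real (path_wt ?J (lprod P) (map Y) (map Z) (i, j, k)) *
            (a i * cnj (a j) * a k * G' (map Y i) * H (map Z k)))"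
    by (rule path_single[OF prob_on_tup[OF P, of n] a1 GH, where Y = "map Y" and Z = "map Z"])
  define F' where "F' xs = F (map fst xs) * cnj (F (map (\<lambda>t. fst (snd t)) xs)) * F (map (\<lambda>t. snd (snd t)) xs)"
    for xs :: "('x \<times> 'x \<times> 'x) list"
  have F': "bounded1 F'"
    unfolding bounded1_def F'_def norm_mult complex_mod_cnj
    using F by (auto simp: bounded1_def intro!: mult_le_one)
  have "(\<Sum>(i, j, k)\<in>path_set ?J (map Y) (map Z). of_real (path_wt ?J (lprod P) (map Y) (map Z) (i, j, k)) *
            (a i * cnj (a j) * a k * G' (map Y i) * H (map Z k)))
    = gcorr (path_set I Y Z) (path_wt I P Y Z) (path_ph \<theta>) (map3 X) (Y \<circ> fst3) (Z \<circ> trd3) n F' G' H"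
    unfolding gcorr_def
  proof (rule sum.reindex_bij_witness[where i = "\<lambda>l. (map fst3 l, map snd3 l, map trd3 l)"
        and j = "\<lambda>(l, l', l''). zip l (zip l' l'')"])
    fix t assume t: "t \<in> path_set ?J (map Y) (map Z)"
    obtain l l' l'' where tt: "t = (l, l', l'')" by (cases t) auto
    have J: "l \<in> ?J" "l' \<in> ?J" "l'' \<in> ?J" and eq: "map Z l = map Z l'" "map Y l' = map Y l''"
      using t by (auto simp: tt path_set_def)
    have len: "length l = n" "length l' = n" "length l'' = n" using J by (auto simp: tup_def)
    define w where "w = zip l (zip l' l'')"
    have w: "map fst3 w = l" "map snd3 w = l'" "map trd3 w = l''"
    proof -
      have "map fst w = l" "map snd w = zip l' l''" using len by (auto simp: w_def)
      then have "map fst (map snd w) = l'" "map snd (map snd w) = l''" "map fst w = l" using len by auto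
      then show "map fst3 w = l" "map snd3 w = l'" "map trd3 w = l''"
        by (simp_all add: proj3 comp_def)
    qed
    then show "(\<lambda>l. (map fst3 l, map snd3 l, map trd3 l)) ((\<lambda>(l, l', l''). zip l (zip l' l'')) t) = t"
      by (simp add: tt w_def)
    have lenw: "length w = n" using len by (simp add: w_def)
    have "p \<in> path_set I Y Z" if pw: "p \<in> set w" for p
    proof -
      obtain k where k: "k < n" "p = (l ! k, l' ! k, l'' ! k)"
        using pw len by (auto simp: w_def set_zip)
      have "l ! k \<in> I" "l' ! k \<in> I" "l'' ! k \<in> I" using k len J by (auto simp: tup_def subset_iff)
      moreover have "Z (l ! k) = Z (l' ! k)" "Y (l' ! k) = Y (l'' ! k)"
        using eq k len by (metis nth_map)+
      ultimately show ?thesis using k by (simp add: path_set_def)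
    qed
    then show "(\<lambda>(l, l', l''). zip l (zip l' l'')) t \<in> tup n (path_set I Y Z)"
      using lenw by (auto simp: tup_def tt w_def)
    have "lprod (path_wt I P Y Z) w = lprod (\<lambda>t. P (fst3 t) * P (snd3 t) * P (trd3 t) /
        (marg I P Z (Z (fst3 t)) * marg I P Y (Y (snd3 t)))) w"
      by (simp add: path_wt_def case_prod_unfold proj3)
    also have "\<dots> = lprod P (map fst3 w) * lprod P (map snd3 w) * lprod P (map trd3 w) /
        (lprod (marg I P Z) (map Z (map fst3 w)) * lprod (marg I P Y) (map Y (map snd3 w)))"
      by (simp only: lprod_divide lprod_mult map_map comp_def)
    also have "\<dots> = path_wt ?J (lprod P) (map Y) (map Z) (l, l', l'')"
      unfolding w by (simp add: path_wt_def marg_tup[OF fin] len)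
    finally have wt: "lprod (path_wt I P Y Z) w = path_wt ?J (lprod P) (map Y) (map Z) (l, l', l'')" .
    have "lprod (path_ph \<theta>) w = lprod (\<lambda>t. \<theta> (fst3 t) * cnj (\<theta> (snd3 t)) * \<theta> (trd3 t)) w"
      by (simp add: path_ph_def case_prod_unfold proj3)
    also have "\<dots> = lprod \<theta> (map fst3 w) * cnj (lprod \<theta> (map snd3 w)) * lprod \<theta> (map trd3 w)"
      by (simp only: lprod_mult map_map comp_def cnj_lprod)
    finally have ph: "lprod (path_ph \<theta>) w = lprod \<theta> l * cnj (lprod \<theta> l') * lprod \<theta> l''" unfolding w .
    have "F' (map (map3 X) w) = F (map X (map fst3 w)) * cnj (F (map X (map snd3 w))) * F (map X (map trd3 w))"
      by (simp add: F'_def map3_def case_prod_unfold comp_def proj3)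
    then have Fw: "F' (map (map3 X) w) = F (map X l) * cnj (F (map X l')) * F (map X l'')" unfolding w .
    have YZ: "map (Y \<circ> fst3) w = map Y l" "map (Z \<circ> trd3) w = map Z l''"
      using w by (simp_all flip: map_map)
    show "of_real (lprod (path_wt I P Y Z) ((\<lambda>(l, l', l''). zip l (zip l' l'')) t)) *
         (lprod (path_ph \<theta>) ((\<lambda>(l, l', l''). zip l (zip l' l'')) t) *
          F' (map (map3 X) ((\<lambda>(l, l', l''). zip l (zip l' l'')) t)) *
          G' (map (Y \<circ> fst3) ((\<lambda>(l, l', l''). zip l (zip l' l'')) t)) *
          H (map (Z \<circ> trd3) ((\<lambda>(l, l', l''). zip l (zip l' l'')) t)))
       = (case t of (i, j, k) \<Rightarrow> of_real (path_wt ?J (lprod P) (map Y) (map Z) (i, j, k)) *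
            (a i * cnj (a j) * a k * G' (map Y i) * H (map Z k)))"
      using wt ph Fw YZ by (simp add: tt w_def[symmetric] a_def ac_simps)
  next
    fix l assume l: "l \<in> tup n (path_set I Y Z)"
    show "(\<lambda>(l, l', l''). zip l (zip l' l'')) (map fst3 l, map snd3 l, map trd3 l) = l"
      by (induction l) (auto simp: proj3)
    show "(map fst3 l, map snd3 l, map trd3 l) \<in> path_set ?J (map Y) (map Z)"
      using l by (fastforce simp: tup_def path_set_def proj3)
  qed
  moreover have "gcorr I P \<theta> X Y Z n F G H = (\<Sum>l\<in>?J. of_real (lprod P l) * (a l * G (map Y l) * H (map Z l)))"
    by (simp add: gcorr_def a_def)
  ultimately show ?thesis using that[OF F' G'] le by simp
qed

text \<open>One round of the path trick costs a factor 4 in the exponent \<open>M\<close>.\<close>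

lemma decay_path:
  assumes P: "prob_on I P" and th: "\<And>i. i \<in> I \<Longrightarrow> norm (\<theta> i) = 1"
    and D: "decay (path_set I Y Z) (path_wt I P Y Z) (path_ph \<theta>) (map3 X) (Y \<circ> fst3) (Z \<circ> trd3)"
  shows "decay I P \<theta> X Y Z"
proof -
  obtain \<rho> M where \<rho>: "0 \<le> \<rho>" "\<rho> < 1" "M > (0::nat)" and
    B: "\<And>n F G H. bounded1 F \<Longrightarrow> bounded1 G \<Longrightarrow> bounded1 H \<Longrightarrow>
       norm (gcorr (path_set I Y Z) (path_wt I P Y Z) (path_ph \<theta>) (map3 X) (Y \<circ> fst3) (Z \<circ> trd3) n F G H) ^ M \<le> \<rho> ^ n"
    using D unfolding decay_def by blast
  have "norm (gcorr I P \<theta> X Y Z n F G H) ^ (4 * M) \<le> \<rho> ^ n"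
    if bd: "bounded1 F" "bounded1 G" "bounded1 H" for n F G H
  proof -
    obtain F' G' where b': "bounded1 F'" "bounded1 G'" and
      le: "norm (gcorr I P \<theta> X Y Z n F G H) ^ 4 \<le>
     norm (gcorr (path_set I Y Z) (path_wt I P Y Z) (path_ph \<theta>) (map3 X) (Y \<circ> fst3) (Z \<circ> trd3) n F' G' H)"
      by (rule path_tup[OF P th bd])
    have "norm (gcorr I P \<theta> X Y Z n F G H) ^ (4 * M) = (norm (gcorr I P \<theta> X Y Z n F G H) ^ 4) ^ M"
      by (simp add: power_mult)
    also have "\<dots> \<le> norm (gcorr (path_set I Y Z) (path_wt I P Y Z) (path_ph \<theta>) (map3 X) (Y \<circ> fst3) (Z \<circ> trd3) n F' G' H) ^ M"
      by (intro power_mono le) simp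
    also have "\<dots> \<le> \<rho> ^ n" using B b' bd by blast
    finally show ?thesis .
  qed
  moreover have "4 * M > 0" using \<rho> by simp
  ultimately show ?thesis unfolding decay_def using \<rho> by blast
qed

lemma prob_on_path:
  assumes P: "prob_on I P"
  shows "prob_on (path_set I Y Z) (path_wt I P Y Z)"
  unfolding prob_on_def
proof (intro conjI ballI)
  have fin: "finite I" using P by (simp add: prob_on_def)
  have eq: "path_set I Y Z = Sigma I (\<lambda>i. Sigma {j\<in>I. Z j = Z i} (\<lambda>j. {k\<in>I. Y k = Y j}))"
    by (auto simp: path_set_def)
  show "finite (path_set I Y Z)" unfolding eq using fin by auto
  show "path_wt I P Y Z x > 0" if "x \<in> path_set I Y Z" for x
    using that P by (auto simp: path_set_def path_wt_def prob_on_def marg_pos[OF P]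
        intro!: divide_pos_pos mult_pos_pos)
  have "sum (path_wt I P Y Z) (path_set I Y Z)
     = (\<Sum>i\<in>I. \<Sum>j\<in>{j\<in>I. Z j = Z i}. \<Sum>k\<in>{k\<in>I. Y k = Y j}. path_wt I P Y Z (i, j, k))"
    unfolding eq using fin by (simp add: sum.Sigma)
  also have "\<dots> = (\<Sum>i\<in>I. \<Sum>j\<in>{j\<in>I. Z j = Z i}. P i * P j / marg I P Z (Z i))"
  proof (intro sum.cong refl)
    fix i j assume i: "i \<in> I" and j: "j \<in> {j\<in>I. Z j = Z i}"
    have "(\<Sum>k\<in>{k\<in>I. Y k = Y j}. path_wt I P Y Z (i, j, k))
       = P i * P j * marg I P Y (Y j) / (marg I P Z (Z i) * marg I P Y (Y j))"
      by (simp add: path_wt_def marg_def sum_distrib_left sum_divide_distrib)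
    then show "(\<Sum>k\<in>{k\<in>I. Y k = Y j}. path_wt I P Y Z (i, j, k)) = P i * P j / marg I P Z (Z i)"
      using marg_pos[OF P, of j Y] j by simp
  qed
  also have "\<dots> = (\<Sum>i\<in>I. P i * marg I P Z (Z i) / marg I P Z (Z i))"
    by (simp add: marg_def sum_distrib_left sum_divide_distrib)
  also have "\<dots> = sum P I"
    using marg_pos[OF P, of _ Z] by (intro sum.cong) (auto simp: less_le)
  finally show "sum (path_wt I P Y Z) (path_set I Y Z) = 1" using P by (simp add: prob_on_def)
qed

section \<open>Walks\<close>

text \<open>A step \<open>(i, j)\<close> follows edge \<open>i\<close> from \<open>E i\<close> to
  the common \<open>D\<close>-value and edge \<open>j\<close> back to \<open>E j\<close>. So
  \<open>m\<close> steps cross \<open>2 * m\<close> edges of the bipartite graph between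
  \<open>E\<close>-values and \<open>D\<close>-values.\<close>

fun walk :: "'i set \<Rightarrow> ('i \<Rightarrow> 'e) \<Rightarrow> ('i \<Rightarrow> 'd) \<Rightarrow> ('i \<times> 'i) list \<Rightarrow> 'e \<Rightarrow> 'e \<Rightarrow> bool" where
  "walk I E D [] e e' \<longleftrightarrow> e = e'"
| "walk I E D ((i, j) # w) e e' \<longleftrightarrow> i \<in> I \<and> j \<in> I \<and> D i = D j \<and> E i = e \<and> walk I E D w (E j) e'"

definition walks :: "'i set \<Rightarrow> ('i \<Rightarrow> 'e) \<Rightarrow> ('i \<Rightarrow> 'd) \<Rightarrow> nat \<Rightarrow> ('i \<times> 'i) list set" where
  "walks I E D m = {w. length w = m \<and> (\<exists>e e'. walk I E D w e e')}"

definition wstart :: "('i \<Rightarrow> 'e) \<Rightarrow> ('i \<times> 'i) list \<Rightarrow> 'e" where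
  "wstart E w = E (fst (hd w))"

definition wend :: "('i \<Rightarrow> 'e) \<Rightarrow> ('i \<times> 'i) list \<Rightarrow> 'e" where
  "wend E w = E (snd (last w))"

definition wrev :: "('i \<times> 'i) list \<Rightarrow> ('i \<times> 'i) list" where
  "wrev w = rev (map prod.swap w)"

text \<open>The second edge of a step is traversed backwards and hence conjugated; reversal of a
  walk then conjugates its phase.\<close>

definition wph :: "('i \<Rightarrow> complex) \<Rightarrow> ('i \<times> 'i) list \<Rightarrow> complex" where
  "wph \<theta> w = lprod (\<lambda>p. \<theta> (fst p) * cnj (\<theta> (snd p))) w"

lemma walk_append: "walk I E D (u @ v) e e' \<longleftrightarrow> (\<exists>m. walk I E D u e m \<and> walk I E D v m e')"
  by (induction u arbitrary: e) auto

lemma walk_ends: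
  assumes "walk I E D w e e'" "w \<noteq> []"
  shows "e = wstart E w" "e' = wend E w"
  using assms
proof (induction w arbitrary: e)
  case (Cons p w)
  { case 1 then show ?case by (cases p) (auto simp: wstart_def) }
  { case 2 then show ?case using Cons.IH(2) by (cases p; cases "w = []") (auto simp: wend_def) }
qed auto

lemma walk_wrev: "walk I E D w e e' \<Longrightarrow> walk I E D (wrev w) e' e"
  by (induction w arbitrary: e) (auto simp: wrev_def walk_append)

lemma wrev_wrev [simp]: "wrev (wrev w) = w"
  by (simp add: wrev_def rev_map)

lemma length_wrev [simp]: "length (wrev w) = length w"
  by (simp add: wrev_def)

lemma wrev_Nil_iff [simp]: "wrev w = [] \<longleftrightarrow> w = []"
  by (simp add: wrev_def)

lemma wph_append: "wph \<theta> (u @ v) = wph \<theta> u * wph \<theta> v"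
  by (simp add: wph_def)

lemma wph_wrev: "wph \<theta> (wrev w) = cnj (wph \<theta> w)"
  by (induction w) (auto simp: wph_def wrev_def)

lemma wend_wrev: "w \<noteq> [] \<Longrightarrow> wend E (wrev w) = wstart E w"
  by (simp add: wstart_def wend_def wrev_def last_rev hd_map)

lemma wstart_append: "u \<noteq> [] \<Longrightarrow> wstart E (u @ v) = wstart E u"
  by (simp add: wstart_def)

lemma wend_append: "v \<noteq> [] \<Longrightarrow> wend E (u @ v) = wend E v"
  by (simp add: wend_def)

lemma walk_set: "walk I E D w e e' \<Longrightarrow> set w \<subseteq> I \<times> I"
proof (induction w arbitrary: e)
  case (Cons p w)
  obtain i j where p: "p = (i, j)" by (cases p)
  have "set w \<subseteq> I \<times> I" by (rule Cons.IH[of "E j"]) (use Cons.prems p in simp)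
  then show ?case using Cons.prems p by simp
qed simp

section \<open>Doubling walks by repeated gluing\<close>

lemma finite_walks:
  assumes "finite I"
  shows "finite (walks I E D m)"
proof (rule finite_subset)
  show "walks I E D m \<subseteq> tup m (I \<times> I)" using walk_set by (fastforce simp: walks_def tup_def)
  show "finite (tup m (I \<times> I))" using assms by simp
qed

lemma walks_1: "walks I E D 1 = (\<lambda>p. [p]) ` glue_set I D"
proof -
  have "walk I E D [(i, j)] (E i) (E j)" if "i \<in> I" "j \<in> I" "D i = D j" for i j using that by simp
  then show ?thesis by (fastforce simp: glue_set_def walks_def length_Suc_conv image_iff)
qed

text \<open>Two walks with the same end are the halves of a walk of double length, the second half
  being run backwards. Positivity of \<open>m\<close> ensures that \<open>wend\<close> is the actual
  end of a walk.\<close>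

lemma walks_glue_bij:
  assumes "m > 0"
  shows "bij_betw (\<lambda>(u, v). u @ wrev v) (glue_set (walks I E D m) (wend E)) (walks I E D (m + m))"
proof (rule bij_betw_byWitness[where f' = "\<lambda>w. (take m w, wrev (drop m w))"])
  show "\<forall>a\<in>glue_set (walks I E D m) (wend E).
      (\<lambda>w. (take m w, wrev (drop m w))) ((\<lambda>(u, v). u @ wrev v) a) = a"
    by (auto simp: glue_set_def walks_def)
  show "\<forall>w\<in>walks I E D (m + m). (\<lambda>(u, v). u @ wrev v) (take m w, wrev (drop m w)) = w"
    by auto
  show "(\<lambda>(u, v). u @ wrev v) ` glue_set (walks I E D m) (wend E) \<subseteq> walks I E D (m + m)"
  proof
    fix w assume "w \<in> (\<lambda>(u, v). u @ wrev v) ` glue_set (walks I E D m) (wend E)"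
    then obtain u v where w: "w = u @ wrev v" "(u, v) \<in> glue_set (walks I E D m) (wend E)" by auto
    then obtain e e' f f' where h: "walk I E D u e e'" "walk I E D v f f'" "length v = m" "length u = m" "wend E u = wend E v"
      by (auto simp: glue_set_def walks_def)
    have "u \<noteq> []" "v \<noteq> []" using h assms by auto
    then have "e' = f'" using h walk_ends(2) by metis
    then have "walk I E D w e f"
      unfolding w using h walk_wrev walk_append by metis
    then show "w \<in> walks I E D (m + m)" using h w by (auto simp: walks_def)
  qed
  show "(\<lambda>w. (take m w, wrev (drop m w))) ` walks I E D (m + m) \<subseteq> glue_set (walks I E D m) (wend E)"
  proof
    fix a assume "a \<in> (\<lambda>w. (take m w, wrev (drop m w))) ` walks I E D (m + m)"
    then obtain w e e' where w: "a = (take m w, wrev (drop m w))" "length w = m + m" "walk I E D w e e'"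
      by (auto simp: walks_def)
    obtain c where c: "walk I E D (take m w) e c" "walk I E D (drop m w) c e'"
      using w(3) by (metis append_take_drop_id walk_append)
    have ne: "take m w \<noteq> []" "drop m w \<noteq> []" using w(2) assms by auto
    show "a \<in> glue_set (walks I E D m) (wend E)"
      using c walk_wrev[OF c(2)] walk_ends[OF c(1) ne(1)] walk_ends[OF c(2) ne(2)] w(2)
      by (auto simp: w(1) glue_set_def walks_def wend_wrev[OF ne(2)])
  qed
qed

text \<open>\<open>L\<close> holds one walk per coordinate. The edges used at time \<open>k\<close>
  in all coordinates form two tuples, at which \<open>\<Psi>\<close> and its conjugate are
  evaluated.\<close>

definition wfun :: "('i list \<Rightarrow> complex) \<Rightarrow> nat \<Rightarrow> ('i \<times> 'i) list list \<Rightarrow> complex" where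
  "wfun \<Psi> m L = (\<Prod>k<m. \<Psi> (map (\<lambda>w. fst (w ! k)) L) * cnj (\<Psi> (map (\<lambda>w. snd (w ! k)) L)))"

lemma wfun_glue:
  assumes L: "L \<in> tup n (glue_set (walks I E D m) (wend E))"
  shows "wfun \<Psi> (m + m) (map (\<lambda>(u, v). u @ wrev v) L) = wfun \<Psi> m (map fst L) * cnj (wfun \<Psi> m (map snd L))"
proof -
  let ?f = "\<lambda>(u, v). u @ wrev v"
  have len: "length (fst p) = m" "length (snd p) = m" if "p \<in> set L" for p
  proof -
    have "p \<in> glue_set (walks I E D m) (wend E)" using L that by (auto simp: tup_def)
    then show "length (fst p) = m" "length (snd p) = m" by (auto simp: glue_set_def walks_def)
  qed
  have 1: "map (\<lambda>w. fst (w ! k)) (map ?f L) = map (\<lambda>w. fst (w ! k)) (map fst L)"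
          "map (\<lambda>w. snd (w ! k)) (map ?f L) = map (\<lambda>w. snd (w ! k)) (map fst L)" if "k < m" for k
    using that len by (auto simp: nth_append case_prod_unfold)
  \<comment> \<open>Time \<open>m + k\<close> of the glued walk is time \<open>m - Suc k\<close> of
    the reversed one, with the two edges of the step exchanged.\<close>
  have 2: "map (\<lambda>w. fst (w ! (m + k))) (map ?f L) = map (\<lambda>w. snd (w ! (m - Suc k))) (map snd L)"
          "map (\<lambda>w. snd (w ! (m + k))) (map ?f L) = map (\<lambda>w. fst (w ! (m - Suc k))) (map snd L)" if "k < m" for k
    using that len by (auto simp: nth_append case_prod_unfold wrev_def rev_nth)
  let ?g = "\<lambda>k. \<Psi> (map (\<lambda>w. fst (w ! k)) (map ?f L)) * cnj (\<Psi> (map (\<lambda>w. snd (w ! k)) (map ?f L)))"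
  have "wfun \<Psi> (m + m) (map ?f L) = (\<Prod>k<m. ?g k) * (\<Prod>k<m. ?g (m + k))"
    unfolding wfun_def by (simp only: lessThan_atLeast0 prod.atLeastLessThan_concat[symmetric, of 0 m "m + m"]
      prod.atLeastLessThan_shift_0[of _ m "m + m"]) (simp add: comp_def)
  also have "(\<Prod>k<m. ?g k) = wfun \<Psi> m (map fst L)"
    unfolding wfun_def by (intro prod.cong refl) (simp only: 1 lessThan_iff)
  also have "(\<Prod>k<m. ?g (m + k)) = (\<Prod>k<m. cnj (\<Psi> (map (\<lambda>w. fst (w ! (m - Suc k))) (map snd L)) *
      cnj (\<Psi> (map (\<lambda>w. snd (w ! (m - Suc k))) (map snd L)))))"
    by (intro prod.cong refl) (simp only: 2 lessThan_iff complex_cnj_mult complex_cnj_cnj mult.commute)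
  also have "\<dots> = (\<Prod>k<m. cnj (\<Psi> (map (\<lambda>w. fst (w ! k)) (map snd L)) *
      cnj (\<Psi> (map (\<lambda>w. snd (w ! k)) (map snd L)))))"
    by (rule prod.nat_diff_reindex)
  also have "\<dots> = cnj (wfun \<Psi> m (map snd L))"
    unfolding wfun_def by simp
  finally show ?thesis .
qed

text \<open>The first gluing, along \<open>D\<close>, removes \<open>\<chi>\<close> and creates
  walks of one step. Each later gluing, along the ends of the walks, removes the factor there,
  copies the factor at the start and doubles the length; this makes \<open>Suc k\<close> squarings
  for length \<open>2 ^ k\<close>.\<close>

lemma walk_power:
  fixes E :: "'i \<Rightarrow> 'e" and D :: "'i \<Rightarrow> 'd"
  assumes P: "prob_on I P"
  shows "\<exists>Q. prob_on (walks I E D (2 ^ k)) Q \<and> (\<forall>n \<Phi> \<chi> \<Psi>. (\<forall>u. norm (\<Phi> u) \<le> 1) \<longrightarrow> (\<forall>u. norm (\<chi> u) \<le> 1) \<longrightarrow>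
     norm (\<Sum>l\<in>tup n I. of_real (lprod P l) * (\<Phi> (map E l) * \<chi> (map D l) * \<Psi> l)) ^ (2 ^ Suc k)
     \<le> norm (\<Sum>L\<in>tup n (walks I E D (2 ^ k)). of_real (lprod Q L) *
          (\<Phi> (map (wstart E) L) * cnj (\<Phi> (map (wend E) L)) * wfun \<Psi> (2 ^ k) L)))"
proof (induction k)
  case 0
  have bij: "bij_betw (\<lambda>p. [p]) (glue_set I D) (walks I E D 1)"
    unfolding walks_1 by (simp add: bij_betw_def inj_on_def)
  define Q where "Q w = glue_wt I P D (hd w)" for w
  have Q: "prob_on (walks I E D 1) Q"
  proof -
    have g: "prob_on (glue_set I D) (glue_wt I P D)" by (rule prob_on_glue[OF P])
    have "sum Q (walks I E D 1) = sum (glue_wt I P D) (glue_set I D)"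
      by (subst sum.reindex_bij_betw[OF bij, symmetric]) (simp add: Q_def)
    moreover have "\<forall>w\<in>walks I E D 1. Q w > 0"
      using g unfolding walks_1 by (auto simp: prob_on_def Q_def)
    moreover have "finite (walks I E D 1)" using P finite_walks by (auto simp: prob_on_def)
    ultimately show ?thesis using g by (simp add: prob_on_def)
  qed
  have "norm (\<Sum>l\<in>tup n I. of_real (lprod P l) * (\<Phi> (map E l) * \<chi> (map D l) * \<Psi> l)) ^ 2
     \<le> norm (\<Sum>L\<in>tup n (walks I E D 1). of_real (lprod Q L) *
          (\<Phi> (map (wstart E) L) * cnj (\<Phi> (map (wend E) L)) * wfun \<Psi> 1 L))"
    if \<Phi>: "\<forall>u. norm (\<Phi> u) \<le> 1" and \<chi>: "\<forall>u. norm (\<chi> u) \<le> 1" for n \<Phi> \<chi> and \<Psi> :: "'i list \<Rightarrow> complex"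
  proof -
    have "norm (\<Sum>l\<in>tup n I. of_real (lprod P l) * \<chi> (map D l) * (\<Phi> (map E l) * \<Psi> l)) ^ 2
      \<le> norm (\<Sum>l\<in>tup n (glue_set I D). of_real (lprod (glue_wt I P D) l) *
          ((\<Phi> (map E (map fst l)) * \<Psi> (map fst l)) * cnj (\<Phi> (map E (map snd l)) * \<Psi> (map snd l))))"
      by (rule glue_tup[OF P]) (use \<chi> in auto)
    also have "(\<Sum>l\<in>tup n (glue_set I D). of_real (lprod (glue_wt I P D) l) *
          ((\<Phi> (map E (map fst l)) * \<Psi> (map fst l)) * cnj (\<Phi> (map E (map snd l)) * \<Psi> (map snd l))))
       = (\<Sum>L\<in>tup n (walks I E D 1). of_real (lprod Q L) *
          (\<Phi> (map (wstart E) L) * cnj (\<Phi> (map (wend E) L)) * wfun \<Psi> 1 L))"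
      unfolding sum_tup_bij[OF bij]
      by (intro sum.cong refl) (simp add: Q_def wstart_def wend_def wfun_def comp_def)
    also have "(\<Sum>l\<in>tup n I. of_real (lprod P l) * \<chi> (map D l) * (\<Phi> (map E l) * \<Psi> l))
      = (\<Sum>l\<in>tup n I. of_real (lprod P l) * (\<Phi> (map E l) * \<chi> (map D l) * \<Psi> l))"
      by (intro sum.cong refl) (simp only: ac_simps)
    finally show ?thesis .
  qed
  then show ?case using Q by (auto intro!: exI[of _ Q])
next
  case (Suc k)
  let ?m = "2 ^ k :: nat"
  obtain Q where Q: "prob_on (walks I E D ?m) Q" and
    IH: "\<And>n \<Phi> \<chi> \<Psi>. \<lbrakk>\<forall>u. norm (\<Phi> u) \<le> 1; \<forall>u. norm (\<chi> u) \<le> 1\<rbrakk> \<Longrightarrow>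
     norm (\<Sum>l\<in>tup n I. of_real (lprod P l) * (\<Phi> (map E l) * \<chi> (map D l) * \<Psi> l)) ^ (2 ^ Suc k)
     \<le> norm (\<Sum>L\<in>tup n (walks I E D ?m). of_real (lprod Q L) *
          (\<Phi> (map (wstart E) L) * cnj (\<Phi> (map (wend E) L)) * wfun \<Psi> ?m L))"
    using Suc.IH by blast
  let ?J = "walks I E D ?m" and ?K = "walks I E D (?m + ?m)"
  let ?f = "\<lambda>(u, v). u @ wrev v"
  have mpos: "?m > 0" by simp
  note bij = walks_glue_bij[OF mpos, of I E D]
  \<comment> \<open>The glued weight, carried over by cutting a walk in the middle.\<close>
  define R where "R w = glue_wt ?J Q (wend E) (take ?m w, wrev (drop ?m w))" for w
  have Rf: "R (?f p) = glue_wt ?J Q (wend E) p" if "p \<in> glue_set ?J (wend E)" for p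
    using that by (auto simp: R_def glue_set_def walks_def)
  have R: "prob_on ?K R"
  proof -
    have g: "prob_on (glue_set ?J (wend E)) (glue_wt ?J Q (wend E))" by (rule prob_on_glue[OF Q])
    have "sum R ?K = sum (glue_wt ?J Q (wend E)) (glue_set ?J (wend E))"
      by (subst sum.reindex_bij_betw[OF bij, symmetric]) (auto intro!: sum.cong simp: Rf)
    moreover have "R w > 0" if w: "w \<in> ?K" for w
    proof -
      obtain p where "p \<in> glue_set ?J (wend E)" "w = ?f p"
        using w bij_betw_imp_surj_on[OF bij] by blast
      then show ?thesis using g Rf[of p] by (simp add: prob_on_def)
    qed
    moreover have "finite ?K" using P finite_walks by (auto simp: prob_on_def)
    ultimately show ?thesis using g by (simp add: prob_on_def)
  qed
  have "norm (\<Sum>l\<in>tup n I. of_real (lprod P l) * (\<Phi> (map E l) * \<chi> (map D l) * \<Psi> l)) ^ (2 ^ Suc (Suc k))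
     \<le> norm (\<Sum>L\<in>tup n ?K. of_real (lprod R L) *
          (\<Phi> (map (wstart E) L) * cnj (\<Phi> (map (wend E) L)) * wfun \<Psi> (?m + ?m) L))"
    if \<Phi>: "\<forall>u. norm (\<Phi> u) \<le> 1" and \<chi>: "\<forall>u. norm (\<chi> u) \<le> 1" for n \<Phi> \<chi> and \<Psi> :: "'i list \<Rightarrow> complex"
  proof -
    let ?A = "\<Sum>l\<in>tup n I. of_real (lprod P l) * (\<Phi> (map E l) * \<chi> (map D l) * \<Psi> l)"
    let ?g = "\<lambda>L. \<Phi> (map (wstart E) L) * wfun \<Psi> ?m L"
    have "norm ?A ^ (2 ^ Suc (Suc k)) = (norm ?A ^ (2 ^ Suc k)) ^ 2"
      by (simp flip: power_mult)
    also have "\<dots> \<le> norm (\<Sum>L\<in>tup n ?J. of_real (lprod Q L) *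
          (\<Phi> (map (wstart E) L) * cnj (\<Phi> (map (wend E) L)) * wfun \<Psi> ?m L)) ^ 2"
      by (intro power_mono IH \<Phi> \<chi>) simp
    also have "(\<Sum>L\<in>tup n ?J. of_real (lprod Q L) *
          (\<Phi> (map (wstart E) L) * cnj (\<Phi> (map (wend E) L)) * wfun \<Psi> ?m L))
       = (\<Sum>L\<in>tup n ?J. of_real (lprod Q L) * cnj (\<Phi> (map (wend E) L)) * ?g L)"
      by (intro sum.cong refl) (simp only: ac_simps)
    also have "norm \<dots> ^ 2 \<le> norm (\<Sum>L\<in>tup n (glue_set ?J (wend E)). of_real (lprod (glue_wt ?J Q (wend E)) L) *
          (?g (map fst L) * cnj (?g (map snd L))))"
      by (rule glue_tup[OF Q, where \<Phi> = "\<lambda>u. cnj (\<Phi> u)"]) (use \<Phi> in auto)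
    also have "(\<Sum>L\<in>tup n (glue_set ?J (wend E)). of_real (lprod (glue_wt ?J Q (wend E)) L) *
          (?g (map fst L) * cnj (?g (map snd L))))
       = (\<Sum>L\<in>tup n ?K. of_real (lprod R L) *
          (\<Phi> (map (wstart E) L) * cnj (\<Phi> (map (wend E) L)) * wfun \<Psi> (?m + ?m) L))"
      unfolding sum_tup_bij[OF bij]
    proof (intro sum.cong refl)
      fix L assume L: "L \<in> tup n (glue_set ?J (wend E))"
      have ne: "fst p \<noteq> []" "snd p \<noteq> []" and pg: "p \<in> glue_set ?J (wend E)" if "p \<in> set L" for p
      proof -
        show "p \<in> glue_set ?J (wend E)" using L that by (auto simp: tup_def)
        then have "length (fst p) = ?m" "length (snd p) = ?m" by (auto simp: glue_set_def walks_def)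
        then show "fst p \<noteq> []" "snd p \<noteq> []" using mpos by (metis list.size(3) less_irrefl)+
      qed
      have "map R (map ?f L) = map (glue_wt ?J Q (wend E)) L"
        using Rf pg by auto
      moreover have "map (wstart E) (map ?f L) = map (wstart E) (map fst L)"
        using ne by (auto simp: case_prod_unfold wstart_append)
      moreover have "map (wend E) (map ?f L) = map (wstart E) (map snd L)"
        using ne by (auto simp: case_prod_unfold wend_append wend_wrev)
      moreover note wfun_glue[OF L, of \<Psi>]
      ultimately show "of_real (lprod (glue_wt ?J Q (wend E)) L) * (?g (map fst L) * cnj (?g (map snd L)))
         = of_real (lprod R (map ?f L)) * (\<Phi> (map (wstart E) (map ?f L)) * cnj (\<Phi> (map (wend E) (map ?f L)))
            * wfun \<Psi> (?m + ?m) (map ?f L))"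
        by (simp only: complex_cnj_mult ac_simps)
    qed
    finally show ?thesis .
  qed
  moreover have eq: "2 ^ Suc k = ?m + ?m" by simp
  ultimately show ?case using R unfolding eq by blast
qed

text \<open>Equality in the triangle inequality would force the terms at \<open>a\<close> and
  \<open>b\<close> to be parallel, but they are positive multiples of different unit
  numbers.\<close>

lemma norm_convex_less:
  fixes \<kappa> :: "'i \<Rightarrow> complex"
  assumes q: "prob_on J q" and k1: "\<And>j. j \<in> J \<Longrightarrow> norm (\<kappa> j) = 1" and ab: "a \<in> J" "b \<in> J" "\<kappa> a \<noteq> \<kappa> b"
  shows "norm (\<Sum>j\<in>J. of_real (q j) * \<kappa> j) < 1"
proof -
  have fin: "finite J" and pos: "\<And>j. j \<in> J \<Longrightarrow> q j > 0" and s1: "sum q J = 1"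
    using q by (auto simp: prob_on_def)
  have ne: "a \<noteq> b" using ab by auto
  let ?f = "\<lambda>j. of_real (q j) * \<kappa> j"
  have nf: "norm (?f j) = q j" if "j \<in> J" for j
    using that pos[OF that] k1 by (simp add: norm_mult)
  have "norm (?f a + ?f b) \<noteq> norm (?f a) + norm (?f b)"
  proof
    assume "norm (?f a + ?f b) = norm (?f a) + norm (?f b)"
    then have "norm (?f a) *\<^sub>R ?f b = norm (?f b) *\<^sub>R ?f a" by (simp only: norm_triangle_eq)
    then have "of_real (q a * q b) * \<kappa> b = of_real (q a * q b) * \<kappa> a"
      using ab by (simp only: nf) (simp add: scaleR_conv_of_real ac_simps)
    then show False using ab pos by (metis mult_cancel_left mult_pos_pos of_real_eq_0_iff less_irrefl)
  qed
  then have lt: "norm (?f a + ?f b) < q a + q b"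
    using norm_triangle_ineq[of "?f a" "?f b"] ab by (simp only: nf less_le) simp
  have split: "sum g J = g a + g b + sum g (J - {a, b})" for g :: "'i \<Rightarrow> 'm::comm_monoid_add"
  proof -
    have "sum g J = g a + sum g (J - {a})" using fin ab by (simp add: sum.remove)
    also have "sum g (J - {a}) = g b + sum g (J - {a} - {b})" using fin ab ne by (intro sum.remove) auto
    also have "J - {a} - {b} = J - {a, b}" by auto
    finally show ?thesis by (simp add: add.assoc)
  qed
  have "norm (sum ?f J) \<le> norm (?f a + ?f b) + norm (sum ?f (J - {a, b}))"
    unfolding split[of ?f] by (rule norm_triangle_ineq)
  also have "norm (sum ?f (J - {a, b})) \<le> sum q (J - {a, b})"
    by (rule sum_norm_le) (simp add: nf)
  finally have "norm (sum ?f J) < q a + q b + sum q (J - {a, b})" using lt by linarith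
  then show ?thesis using split[of q] s1 by simp
qed

lemma wfun_mult: "wfun (\<lambda>l. f l * g l) m L = wfun f m L * wfun g m L"
  unfolding wfun_def by (simp add: prod.distrib ac_simps)

lemma wfun_lprod:
  assumes "\<And>w. w \<in> set L \<Longrightarrow> length w = m"
  shows "wfun (lprod \<theta>) m L = lprod (wph \<theta>) L"
  using assms
proof (induction L)
  case Nil
  then show ?case by (simp add: wfun_def)
next
  case (Cons w L)
  have "wph \<theta> w = (\<Prod>k<m. \<theta> (fst (w ! k)) * cnj (\<theta> (snd (w ! k))))"
    using Cons.prems[of w] by (simp add: wph_def prod.list_conv_set_nth atLeast0LessThan)
  then have "wfun (lprod \<theta>) m (w # L) = wph \<theta> w * wfun (lprod \<theta>) m L"
    unfolding wfun_def by (simp add: prod.distrib ac_simps)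
  then show ?case using Cons by simp
qed

lemma norm_wph:
  assumes "walk I E D w e e'" "\<And>i. i \<in> I \<Longrightarrow> norm (\<theta> i) = 1"
  shows "norm (wph \<theta> w) = 1"
  using assms by (induction w arbitrary: e) (auto simp: wph_def norm_mult)

text \<open>Three stages. Walks between \<open>Y\<close>-values remove \<open>F\<close>. Each such
  walk is then treated as an edge from its input \<open>U\<close> to its output \<open>R\<close>,
  and walks along these edges remove the functions of the output. A last gluing along start and end
  removes the rest. Only phases survive, so the bound is the \<open>n\<close>-th power of one
  average, which has norm below 1 because \<open>W\<close> and \<open>W'\<close> contribute
  different unit numbers to it.\<close>

lemma decay_of_walks:
  fixes X :: "'i \<Rightarrow> 'x" and Y :: "'i \<Rightarrow> 'y" and Z :: "'i \<Rightarrow> 'z"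
  assumes P: "prob_on I P" and th: "\<And>i. i \<in> I \<Longrightarrow> norm (\<theta> i) = 1"
  defines "C \<equiv> \<lambda>a. walks I Y X (2 ^ a)"
    and "U \<equiv> \<lambda>c. (wstart Y c, map (Z \<circ> fst) c)"
    and "R \<equiv> \<lambda>c. (wend Y c, map (Z \<circ> snd) c)"
  assumes W: "W \<in> walks (C a) U R (2 ^ b)" "W' \<in> walks (C a) U R (2 ^ b)"
    and ends: "wstart U W = wstart U W'" "wend U W = wend U W'"
    and ph: "wph (wph \<theta>) W \<noteq> wph (wph \<theta>) W'"
  shows "decay I P \<theta> X Y Z"
proof -
  obtain Q1 where Q1: "prob_on (C a) Q1" and
    L1: "\<And>n \<Phi> \<chi> \<Psi>. \<lbrakk>\<forall>u. norm (\<Phi> u) \<le> 1; \<forall>u. norm (\<chi> u) \<le> 1\<rbrakk> \<Longrightarrow>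
     norm (\<Sum>l\<in>tup n I. of_real (lprod P l) * (\<Phi> (map Y l) * \<chi> (map X l) * \<Psi> l)) ^ (2 ^ Suc a)
     \<le> norm (\<Sum>L\<in>tup n (C a). of_real (lprod Q1 L) *
          (\<Phi> (map (wstart Y) L) * cnj (\<Phi> (map (wend Y) L)) * wfun \<Psi> (2 ^ a) L))"
    using walk_power[OF P, where E = Y and D = X and k = a] unfolding C_def by blast
  let ?J = "walks (C a) U R (2 ^ b)"
  obtain Q2 where Q2: "prob_on ?J Q2" and
    L2: "\<And>n \<Phi> \<chi> \<Psi>. \<lbrakk>\<forall>u. norm (\<Phi> u) \<le> 1; \<forall>u. norm (\<chi> u) \<le> 1\<rbrakk> \<Longrightarrow>
     norm (\<Sum>l\<in>tup n (C a). of_real (lprod Q1 l) * (\<Phi> (map U l) * \<chi> (map R l) * \<Psi> l)) ^ (2 ^ Suc b)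
     \<le> norm (\<Sum>L\<in>tup n ?J. of_real (lprod Q2 L) *
          (\<Phi> (map (wstart U) L) * cnj (\<Phi> (map (wend U) L)) * wfun \<Psi> (2 ^ b) L))"
    using walk_power[OF Q1, where E = U and D = R and k = b] by blast
  define V where "V w = (wstart U w, wend U w)" for w
  define \<tau> where "\<tau> = wph (wph \<theta>)"
  define q where "q = glue_wt ?J Q2 V"
  define K where "K = glue_set ?J V"
  have q: "prob_on K q" unfolding q_def K_def by (rule prob_on_glue[OF Q2])
  define \<kappa> where "\<kappa> p = \<tau> (fst p) * cnj (\<tau> (snd p))" for p
  have nC: "norm (wph \<theta> c) = 1" if "c \<in> C a" for c
    using that norm_wph[OF _ th] by (auto simp: C_def walks_def)
  have nJ: "norm (\<tau> w) = 1" if "w \<in> ?J" for w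
    using that norm_wph[OF _ nC] unfolding \<tau>_def by (auto simp: walks_def)
  have n\<kappa>: "norm (\<kappa> p) = 1" if "p \<in> K" for p
    using that nJ by (auto simp: \<kappa>_def K_def glue_set_def norm_mult)
  have "(W, W) \<in> K" "(W, W') \<in> K" using W ends by (auto simp: K_def glue_set_def V_def)
  moreover have "\<kappa> (W, W) \<noteq> \<kappa> (W, W')"
    using ph nJ[OF W(1)] unfolding \<kappa>_def \<tau>_def by auto
  ultimately have \<sigma>: "norm (\<Sum>p\<in>K. of_real (q p) * \<kappa> p) < 1"
    by (intro norm_convex_less[OF q n\<kappa>]) auto
  let ?\<sigma> = "\<Sum>p\<in>K. of_real (q p) * \<kappa> p"
  \<comment> \<open>\<open>Suc a\<close> squarings in the first stage, \<open>Suc b\<close> in the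
    second and one in the last.\<close>
  let ?M = "2 ^ Suc a * 2 ^ Suc b * 2 :: nat"
  have "norm (gcorr I P \<theta> X Y Z n F G H) ^ ?M \<le> norm ?\<sigma> ^ n"
    if bd: "bounded1 F" "bounded1 G" "bounded1 H" for n F G H
  proof -
    let ?c = "gcorr I P \<theta> X Y Z n F G H"
    define \<Psi> where "\<Psi> l = lprod \<theta> l * H (map Z l)" for l
    \<comment> \<open>All functions that see the input of a walk: \<open>G\<close> at its start and
      \<open>H\<close> at the first edge of every step. The output carries the conjugate of the same
      \<open>\<Phi>\<close>.\<close>
    define \<Phi> where "\<Phi> us = G (map fst us) * (\<Prod>k<2 ^ a. H (map (\<lambda>u. snd u ! k) us))" for us :: "('y \<times> 'z list) list"
    have b\<Phi>: "\<forall>us. norm (\<Phi> us) \<le> 1"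
    proof
      fix us :: "('y \<times> 'z list) list"
      have "norm (\<Prod>k<2 ^ a. H (map (\<lambda>u. snd u ! k) us)) \<le> 1"
        unfolding prod_norm[symmetric] using bd by (intro prod_le_1) (auto simp: bounded1_def)
      then show "norm (\<Phi> us) \<le> 1" using bd unfolding \<Phi>_def norm_mult by (intro mult_le_one) (auto simp: bounded1_def)
    qed
    let ?S1 = "\<Sum>L\<in>tup n (C a). of_real (lprod Q1 L) *
          (G (map (wstart Y) L) * cnj (G (map (wend Y) L)) * wfun \<Psi> (2 ^ a) L)"
    let ?S2 = "\<Sum>L\<in>tup n ?J. of_real (lprod Q2 L) *
          (\<Phi> (map (wstart U) L) * cnj (\<Phi> (map (wend U) L)) * wfun (lprod (wph \<theta>)) (2 ^ b) L)"
    have "?c = (\<Sum>l\<in>tup n I. of_real (lprod P l) * (G (map Y l) * F (map X l) * \<Psi> l))"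
      unfolding gcorr_def \<Psi>_def by (intro sum.cong refl) (simp only: ac_simps)
    then have 1: "norm ?c ^ (2 ^ Suc a) \<le> norm ?S1"
      using L1[where \<Phi> = G and \<chi> = F and \<Psi> = \<Psi> and n = n,
          OF bd(2)[unfolded bounded1_def] bd(1)[unfolded bounded1_def]] by (simp only:)
    have "?S1 = (\<Sum>L\<in>tup n (C a). of_real (lprod Q1 L) * (\<Phi> (map U L) * cnj (\<Phi> (map R L)) * lprod (wph \<theta>) L))"
    proof (intro sum.cong refl)
      fix L assume L: "L \<in> tup n (C a)"
      have len: "length w = 2 ^ a" if "w \<in> set L" for w
        using L that by (auto simp: tup_def C_def walks_def)
      have "wfun \<Psi> (2 ^ a) L = lprod (wph \<theta>) L * wfun (\<lambda>l. H (map Z l)) (2 ^ a) L"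
        unfolding \<Psi>_def wfun_mult using wfun_lprod[of L "2 ^ a" \<theta>] len by simp
      moreover have "wfun (\<lambda>l. H (map Z l)) (2 ^ a) L
          = (\<Prod>k<2 ^ a. H (map (\<lambda>u. snd u ! k) (map U L))) * cnj (\<Prod>k<2 ^ a. H (map (\<lambda>u. snd u ! k) (map R L)))"
      proof -
        have "map Z (map (\<lambda>w. fst (w ! k)) L) = map (\<lambda>u. snd u ! k) (map U L)"
          "map Z (map (\<lambda>w. snd (w ! k)) L) = map (\<lambda>u. snd u ! k) (map R L)" if "k < 2 ^ a" for k
          using that len by (auto simp: U_def R_def)
        then show ?thesis unfolding wfun_def cnj_prod prod.distrib[symmetric]
          by (intro prod.cong refl) (simp only: lessThan_iff)
      qed
      moreover have "map (wstart Y) L = map fst (map U L)" "map (wend Y) L = map fst (map R L)"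
        by (auto simp: U_def R_def)
      ultimately show "of_real (lprod Q1 L) * (G (map (wstart Y) L) * cnj (G (map (wend Y) L)) * wfun \<Psi> (2 ^ a) L)
          = of_real (lprod Q1 L) * (\<Phi> (map U L) * cnj (\<Phi> (map R L)) * lprod (wph \<theta>) L)"
        unfolding \<Phi>_def by (simp only: complex_cnj_mult ac_simps)
    qed
    then have 2: "norm ?S1 ^ (2 ^ Suc b) \<le> norm ?S2"
      using L2[where \<Phi> = \<Phi> and \<chi> = "\<lambda>r. cnj (\<Phi> r)" and n = n and \<Psi> = "lprod (wph \<theta>)",
          OF b\<Phi>] b\<Phi> by (simp only: complex_mod_cnj simp_thms)
    have "?S2 = (\<Sum>L\<in>tup n ?J. of_real (lprod Q2 L) *
          (\<Phi> (map fst (map V L)) * cnj (\<Phi> (map snd (map V L)))) * lprod \<tau> L)"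
    proof (intro sum.cong refl)
      fix L assume L: "L \<in> tup n ?J"
      have "wfun (lprod (wph \<theta>)) (2 ^ b) L = lprod \<tau> L"
        unfolding \<tau>_def using L by (intro wfun_lprod) (auto simp: tup_def walks_def)
      moreover have "map (wstart U) L = map fst (map V L)" "map (wend U) L = map snd (map V L)"
        by (auto simp: V_def)
      ultimately show "of_real (lprod Q2 L) *
          (\<Phi> (map (wstart U) L) * cnj (\<Phi> (map (wend U) L)) * wfun (lprod (wph \<theta>)) (2 ^ b) L)
        = of_real (lprod Q2 L) *
          (\<Phi> (map fst (map V L)) * cnj (\<Phi> (map snd (map V L)))) * lprod \<tau> L"
        by (simp only: mult.assoc)
    qed
    also have "norm \<dots> ^ 2 \<le> norm (\<Sum>L\<in>tup n K. of_real (lprod q L) * (lprod \<tau> (map fst L) * cnj (lprod \<tau> (map snd L))))"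
      unfolding q_def K_def
    proof (rule glue_tup[OF Q2, where \<Phi> = "\<lambda>vs. \<Phi> (map fst vs) * cnj (\<Phi> (map snd vs))"])
      show "norm (\<Phi> (map fst u) * cnj (\<Phi> (map snd u))) \<le> 1" for u
        using b\<Phi> unfolding norm_mult by (intro mult_le_one) auto
    qed
    also have "(\<Sum>L\<in>tup n K. of_real (lprod q L) * (lprod \<tau> (map fst L) * cnj (lprod \<tau> (map snd L))))
      = (\<Sum>L\<in>tup n K. lprod (\<lambda>p. of_real (q p) * \<kappa> p) L)"
      by (intro sum.cong refl) (simp add: \<kappa>_def lprod_mult of_real_lprod cnj_lprod comp_def)
    also have "\<dots> = ?\<sigma> ^ n" by (rule sum_tup_lprod)
    finally have 3: "norm ?S2 ^ 2 \<le> norm ?\<sigma> ^ n" by (simp add: norm_power)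
    have "norm ?c ^ ?M = ((norm ?c ^ (2 ^ Suc a)) ^ (2 ^ Suc b)) ^ 2" by (simp only: power_mult)
    also have "\<dots> \<le> (norm ?S1 ^ (2 ^ Suc b)) ^ 2"
      using 1 by (intro power_mono) auto
    also have "\<dots> \<le> norm ?S2 ^ 2" using 2 by (intro power_mono) auto
    also note 3
    finally show ?thesis .
  qed
  moreover have "?M > 0" by simp
  ultimately show ?thesis unfolding decay_def using \<sigma> norm_ge_zero by blast
qed

section \<open>Solving multiplicative equations over the unit circle\<close>

text \<open>A unitary character on a submonoid of the free commutative monoid. Nonnegative
  combinations replace integer ones, and cancellation of multisets replaces subtraction.\<close>

definition char_on :: "'v multiset set \<Rightarrow> ('v multiset \<Rightarrow> complex) \<Rightarrow> bool" where
  "char_on S \<phi> \<longleftrightarrow> {#} \<in> S \<and> (\<forall>m\<in>S. \<forall>m'\<in>S. m + m' \<in> S \<and> \<phi> (m + m') = \<phi> m * \<phi> m') \<and> (\<forall>m\<in>S. norm (\<phi> m) = 1)"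

lemma unit_root_exists:
  fixes c :: complex
  assumes "norm c = 1" "d > 0"
  obtains r where "norm r = 1" "r ^ d = c"
proof -
  let ?r = "cis (Arg c / real d)"
  have "?r ^ d = cis (Arg c)" using assms by (simp add: Complex.DeMoivre)
  also have "\<dots> = c" using assms by (subst cis_Arg) (auto simp: sgn_eq)
  finally show ?thesis using that[of ?r] by simp
qed

text \<open>\<open>r\<close> is an admissible value at the new symbol \<open>a\<close>. If no two
  elements of \<open>S\<close> differ by a positive number of copies of \<open>a\<close>, the value
  1 will do. Otherwise \<open>r\<close> is a root belonging to the least such number, and larger
  differences are reduced by subtracting it repeatedly.\<close>

lemma char_on_root:
  assumes ch: "char_on S \<phi>"
  obtains r where "norm r = 1" and "\<And>d m m'. \<lbrakk>m \<in> S; m' \<in> S; m = m' + replicate_mset d a\<rbrakk> \<Longrightarrow> \<phi> m = \<phi> m' * r ^ d"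
proof (cases "\<exists>d>0. \<exists>m\<in>S. \<exists>m'\<in>S. m = m' + replicate_mset d a")
  case False
  have "\<phi> m = \<phi> m' * 1 ^ d" if h: "m \<in> S" "m' \<in> S" "m = m' + replicate_mset d a" for d m m'
  proof -
    have "\<exists>m\<in>S. \<exists>m'\<in>S. m = m' + replicate_mset d a" by (intro bexI[of _ m] bexI[of _ m'] h)
    then have "d = 0" using False by (metis neq0_conv)
    then show ?thesis using h(3) by simp
  qed
  then show ?thesis by (rule that[of 1, rotated]) simp_all
next
  case True
  define Q where "Q d \<longleftrightarrow> d > 0 \<and> (\<exists>m\<in>S. \<exists>m'\<in>S. m = m' + replicate_mset d a)" for d
  define d0 where "d0 = (LEAST d. Q d)"
  have "Q d0" unfolding d0_def by (rule LeastI_ex) (use True in \<open>auto simp: Q_def\<close>)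
  then obtain m0 m0' where d0: "d0 > 0" "m0 \<in> S" "m0' \<in> S" "m0 = m0' + replicate_mset d0 a"
    by (auto simp: Q_def)
  have min: "d0 \<le> d" if "Q d" for d using that unfolding d0_def by (rule Least_le)
  have nz: "\<phi> m \<noteq> 0" if "m \<in> S" for m using ch that by (auto simp: char_on_def)
  have "norm (\<phi> m0 / \<phi> m0') = 1" using ch d0 by (simp add: char_on_def norm_divide)
  then obtain r where r: "norm r = 1" "r ^ d0 = \<phi> m0 / \<phi> m0'" using unit_root_exists d0(1) by blast
  have "\<phi> m = \<phi> m' * r ^ d" if "m \<in> S" "m' \<in> S" "m = m' + replicate_mset d a" for d m m'
    using that
  proof (induction d arbitrary: m m' rule: less_induct)
    case (less d)
    show ?case
    proof (cases "d = 0")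
      case True
      then show ?thesis using less.prems by simp
    next
      case False
      then have "d0 \<le> d" using less.prems by (intro min) (auto simp: Q_def)
      have "replicate_mset d a = replicate_mset d0 a + replicate_mset (d - d0) a"
        using \<open>d0 \<le> d\<close> by (auto intro!: multiset_eqI)
      \<comment> \<open>Subtraction without inverses: adding \<open>m0'\<close> on one side and
        \<open>m0\<close> on the other lowers the difference from \<open>d\<close> to
        \<open>d - d0\<close>.\<close>
      then have "m + m0' = (m' + m0) + replicate_mset (d - d0) a"
        using less.prems d0 by (simp add: ac_simps)
      moreover have "m + m0' \<in> S" "m' + m0 \<in> S" using ch less.prems d0 by (auto simp: char_on_def)
      ultimately have "\<phi> (m + m0') = \<phi> (m' + m0) * r ^ (d - d0)"
        using less.IH[of "d - d0"] d0(1) False by simp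
      then have "\<phi> m * \<phi> m0' = \<phi> m' * \<phi> m0 * r ^ (d - d0)"
        using ch less.prems d0 by (simp add: char_on_def)
      then have "\<phi> m = \<phi> m' * (\<phi> m0 / \<phi> m0') * r ^ (d - d0)"
        using nz[OF d0(3)] by (simp add: field_simps)
      also have "\<dots> = \<phi> m' * (r ^ d0 * r ^ (d - d0))" using r by simp
      also have "r ^ d0 * r ^ (d - d0) = r ^ d" using \<open>d0 \<le> d\<close> by (simp flip: power_add)
      finally show ?thesis .
    qed
  qed
  then show ?thesis using that r by blast
qed

text \<open>An element of \<open>S\<close> plus \<open>k\<close> copies of \<open>a\<close> is sent
  to \<open>\<phi> m * r ^ k\<close>; the choice of \<open>r\<close> makes this independent of the
  decomposition.\<close>

lemma char_on_extend:
  assumes ch: "char_on S \<phi>"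
  obtains S' \<phi>' where "char_on S' \<phi>'" "S \<subseteq> S'" "{#a#} \<in> S'" "\<And>m. m \<in> S \<Longrightarrow> \<phi>' m = \<phi> m"
proof -
  obtain r where r: "norm r = 1" and
    ext: "\<And>d m m'. \<lbrakk>m \<in> S; m' \<in> S; m = m' + replicate_mset d a\<rbrakk> \<Longrightarrow> \<phi> m = \<phi> m' * r ^ d"
    using char_on_root[OF ch] by metis
  have le: "\<phi> m * r ^ k = \<phi> m' * r ^ k'"
    if h: "m \<in> S" "m' \<in> S" "m + replicate_mset k a = m' + replicate_mset k' a" "k \<le> k'" for m m' k k'
  proof -
    have "replicate_mset k' a = replicate_mset (k' - k) a + replicate_mset k a"
      using h(4) by (auto intro!: multiset_eqI)
    then have "m = m' + replicate_mset (k' - k) a" using h(3) by (simp add: add.assoc[symmetric])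
    then have "\<phi> m * r ^ k = \<phi> m' * r ^ (k' - k) * r ^ k" using ext[OF h(1,2)] by simp
    also have "\<dots> = \<phi> m' * r ^ k'" using h(4) by (simp add: mult.assoc flip: power_add)
    finally show ?thesis .
  qed
  have wd: "\<phi> m * r ^ k = \<phi> m' * r ^ k'"
    if "m \<in> S" "m' \<in> S" "m + replicate_mset k a = m' + replicate_mset k' a" for m m' k k'
    using le[of m m' k k'] le[of m' m k' k] that by (metis nat_le_linear)
  define S' where "S' = {m + replicate_mset k a | m k. m \<in> S}"
  define \<phi>' where "\<phi>' x = (SOME c. \<exists>m k. m \<in> S \<and> x = m + replicate_mset k a \<and> c = \<phi> m * r ^ k)" for x
  have val: "\<phi>' (m + replicate_mset k a) = \<phi> m * r ^ k" if "m \<in> S" for m k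
  proof -
    have "\<exists>c. \<exists>m' k'. m' \<in> S \<and> m + replicate_mset k a = m' + replicate_mset k' a \<and> c = \<phi> m' * r ^ k'"
      using that by blast
    from someI_ex[OF this] show ?thesis unfolding \<phi>'_def using wd that by metis
  qed
  have "char_on S' \<phi>'"
    unfolding char_on_def
  proof (intro conjI ballI)
    show "{#} \<in> S'" using ch unfolding S'_def char_on_def by (auto intro!: exI[of _ "{#}"] exI[of _ 0])
  next
    fix x y assume "x \<in> S'" "y \<in> S'"
    then obtain m k m' k' where xy: "m \<in> S" "m' \<in> S" "x = m + replicate_mset k a" "y = m' + replicate_mset k' a"
      unfolding S'_def by blast
    have mm: "m + m' \<in> S" "\<phi> (m + m') = \<phi> m * \<phi> m'" using ch xy by (auto simp: char_on_def)
    have "replicate_mset (k + k') a = replicate_mset k a + replicate_mset k' a"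
      by (auto intro!: multiset_eqI)
    then have eq: "x + y = (m + m') + replicate_mset (k + k') a" unfolding xy by (simp add: ac_simps)
    show "x + y \<in> S'" unfolding eq S'_def using mm by blast
    show "\<phi>' (x + y) = \<phi>' x * \<phi>' y"
      unfolding eq val[OF mm(1)] unfolding xy val[OF xy(1)] val[OF xy(2)] mm(2) power_add by (simp only: ac_simps)
  next
    fix x assume "x \<in> S'"
    then obtain m k where "m \<in> S" "x = m + replicate_mset k a" unfolding S'_def by blast
    then show "norm (\<phi>' x) = 1" using val ch r by (simp add: char_on_def norm_mult norm_power)
  qed
  moreover have in1: "m \<in> S'" "\<phi>' m = \<phi> m" if "m \<in> S" for m
  proof -
    have "m = m + replicate_mset 0 a" by simp
    then show "m \<in> S'" unfolding S'_def using that by blast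
    show "\<phi>' m = \<phi> m" using val[OF that, of 0] by simp
  qed
  moreover have "{#a#} \<in> S'"
    unfolding S'_def using ch by (auto simp: char_on_def intro!: exI[of _ "{#}"] exI[of _ 1])
  ultimately show ?thesis using that[of S' \<phi>'] by blast
qed

text \<open>Injectivity of the divisible group of unit complex numbers.\<close>

lemma unit_equations_solvable:
  fixes v :: "'i \<Rightarrow> 'v multiset" and \<theta> :: "'i \<Rightarrow> complex"
  assumes fin: "finite I" and th: "\<And>i. i \<in> I \<Longrightarrow> norm (\<theta> i) = 1"
    and cons: "\<And>L L'. \<lbrakk>set L \<subseteq> I; set L' \<subseteq> I; sum_list (map v L) = sum_list (map v L')\<rbrakk> \<Longrightarrow> lprod \<theta> L = lprod \<theta> L'"
  obtains \<chi> where "\<And>a. norm (\<chi> a) = 1" "\<And>i. i \<in> I \<Longrightarrow> \<theta> i = (\<Prod>a\<in>#v i. \<chi> a)"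
proof -
  \<comment> \<open>By \<open>cons\<close>, the product of \<open>\<theta>\<close> over a list
    depends only on the sum of the \<open>v i\<close>. This gives a character on the submonoid they
    generate, which is then extended to every symbol in turn.\<close>
  define S0 where "S0 = {sum_list (map v L) | L. set L \<subseteq> I}"
  define \<phi>0 where "\<phi>0 m = (SOME c. \<exists>L. set L \<subseteq> I \<and> m = sum_list (map v L) \<and> c = lprod \<theta> L)" for m
  have val: "\<phi>0 (sum_list (map v L)) = lprod \<theta> L" if "set L \<subseteq> I" for L
  proof -
    have "\<exists>c. \<exists>L'. set L' \<subseteq> I \<and> sum_list (map v L) = sum_list (map v L') \<and> c = lprod \<theta> L'"
      using that by blast
    from someI_ex[OF this] show ?thesis unfolding \<phi>0_def using cons that by metis
  qed
  have nrm: "norm (lprod \<theta> L) = 1" if "set L \<subseteq> I" for L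
    using that th by (induction L) (auto simp: norm_mult)
  have ch0: "char_on S0 \<phi>0"
    unfolding char_on_def
  proof (intro conjI ballI)
    show "{#} \<in> S0" unfolding S0_def by (auto intro!: exI[of _ "[]"])
  next
    fix x y assume "x \<in> S0" "y \<in> S0"
    then obtain L L' where L: "set L \<subseteq> I" "set L' \<subseteq> I" "x = sum_list (map v L)" "y = sum_list (map v L')"
      unfolding S0_def by blast
    have eq: "x + y = sum_list (map v (L @ L'))" and LL: "set (L @ L') \<subseteq> I" using L by auto
    show "x + y \<in> S0" unfolding eq S0_def using LL by blast
    show "\<phi>0 (x + y) = \<phi>0 x * \<phi>0 y" unfolding eq val[OF LL] unfolding L val[OF L(1)] val[OF L(2)] by simp
  next
    fix x assume "x \<in> S0"
    then show "norm (\<phi>0 x) = 1" using val nrm unfolding S0_def by auto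
  qed
  define V where "V = (\<Union>i\<in>I. set_mset (v i))"
  have "finite V" using fin by (simp add: V_def)
  then have "\<exists>S \<phi>. char_on S \<phi> \<and> S0 \<subseteq> S \<and> (\<forall>a\<in>V. {#a#} \<in> S) \<and> (\<forall>m\<in>S0. \<phi> m = \<phi>0 m)"
  proof (induction V rule: finite_induct)
    case empty
    then show ?case using ch0 by blast
  next
    case (insert a V)
    then obtain S \<phi> where S: "char_on S \<phi>" "S0 \<subseteq> S" "\<forall>a\<in>V. {#a#} \<in> S" "\<forall>m\<in>S0. \<phi> m = \<phi>0 m" by blast
    obtain S' \<phi>' where S': "char_on S' \<phi>'" "S \<subseteq> S'" "{#a#} \<in> S'" "\<And>m. m \<in> S \<Longrightarrow> \<phi>' m = \<phi> m"
      using char_on_extend[OF S(1)] by metis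
    show ?case using S S' by (intro exI[of _ S'] exI[of _ \<phi>']) auto
  qed
  then obtain S \<phi> where S: "char_on S \<phi>" "S0 \<subseteq> S" "\<forall>a\<in>V. {#a#} \<in> S" "\<forall>m\<in>S0. \<phi> m = \<phi>0 m" by blast
  \<comment> \<open>Symbols outside \<open>V\<close> occur in no \<open>v i\<close>; the default 1
    keeps \<open>\<chi>\<close> unimodular there.\<close>
  define \<chi> where "\<chi> a = (if a \<in> V then \<phi> {#a#} else 1)" for a
  have "\<phi> {#} * \<phi> {#} = \<phi> {#}" "\<phi> {#} \<noteq> 0"
  proof -
    have "{#} + {#} = ({#} :: 'v multiset)" by simp
    then show "\<phi> {#} * \<phi> {#} = \<phi> {#}" using S(1) unfolding char_on_def by metis
    show "\<phi> {#} \<noteq> 0" using S(1) unfolding char_on_def by (metis norm_zero zero_neq_one)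
  qed
  then have \<phi>0: "\<phi> {#} = 1" by simp
  have prod: "m \<in> S \<and> \<phi> m = (\<Prod>a\<in>#m. \<chi> a)" if "set_mset m \<subseteq> V" for m
    using that
  proof (induction m)
    case empty
    then show ?case using S \<phi>0 by (simp add: char_on_def)
  next
    case (add a m)
    then have m: "m \<in> S" "\<phi> m = (\<Prod>a\<in>#m. \<chi> a)" "{#a#} \<in> S" "a \<in> V" using S by auto
    then have "{#a#} + m \<in> S \<and> \<phi> ({#a#} + m) = \<phi> {#a#} * \<phi> m" using S(1) unfolding char_on_def by blast
    then show ?case using m by (simp add: \<chi>_def)
  qed
  have "\<theta> i = (\<Prod>a\<in>#v i. \<chi> a)" if "i \<in> I" for i
  proof -
    have "v i \<in> S0" unfolding S0_def using that by (auto intro!: exI[of _ "[i]"])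
    moreover have "\<phi>0 (v i) = \<theta> i" using val[of "[i]"] that by simp
    moreover have "set_mset (v i) \<subseteq> V" using that by (auto simp: V_def)
    ultimately show ?thesis using prod S(4) by metis
  qed
  moreover have "norm (\<chi> a) = 1" for a using S(1,3) by (auto simp: \<chi>_def char_on_def)
  ultimately show ?thesis using that by blast
qed

text \<open>Factors are taken on the unit circle, so that solvability of equations in this divisible
  group applies; they lie in the disk as well.\<close>

definition embeddable :: "'i set \<Rightarrow> ('i \<Rightarrow> complex) \<Rightarrow> ('i \<Rightarrow> 'x) \<Rightarrow> ('i \<Rightarrow> 'y) \<Rightarrow> ('i \<Rightarrow> 'z) \<Rightarrow> bool" where
  "embeddable I \<theta> X Y Z \<longleftrightarrow> (\<exists>A B C. (\<forall>x. norm (A x) = 1) \<and> (\<forall>y. norm (B y) = 1) \<and> (\<forall>z. norm (C z) = (1::real)) \<and>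
     (\<forall>i\<in>I. A (X i) * B (Y i) * C (Z i) * \<theta> i = 1))"

lemma unit_cnj: "norm (c::complex) = 1 \<Longrightarrow> c * cnj c = 1"
  by (simp add: complex_mult_cnj cmod_def)

text \<open>An embedding is a solution of equations over the unit circle with one unknown per
  symbol, where \<open>v i\<close> collects the three symbols of \<open>i\<close>. If there is none,
  \<theta> violates a relation among the \<open>v i\<close>, and its two sides are the lists
  \<open>L\<close> and \<open>L'\<close>.\<close>

lemma not_embeddable_lists:
  fixes X :: "'i \<Rightarrow> 'x" and Y :: "'i \<Rightarrow> 'y" and Z :: "'i \<Rightarrow> 'z"
  assumes fin: "finite I" and th: "\<And>i. i \<in> I \<Longrightarrow> norm (\<theta> i) = 1" and ne: "\<not> embeddable I \<theta> X Y Z"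
  obtains L L' where "set L \<subseteq> I" "set L' \<subseteq> I" "mset (map X L) = mset (map X L')"
    "mset (map Y L) = mset (map Y L')" "mset (map Z L) = mset (map Z L')" "lprod \<theta> L \<noteq> lprod \<theta> L'"
proof (rule ccontr)
  assume not: "\<not> thesis"
  note found = that
  define v :: "'i \<Rightarrow> ('x + 'y + 'z) multiset" where "v i = {#Inl (X i), Inr (Inl (Y i)), Inr (Inr (Z i))#}" for i
  have cnt: "count (sum_list (map v L)) (Inl x) = count (mset (map X L)) x"
    "count (sum_list (map v L)) (Inr (Inl y)) = count (mset (map Y L)) y"
    "count (sum_list (map v L)) (Inr (Inr z)) = count (mset (map Z L)) z" for L x y z
    by (induction L) (auto simp: v_def)
  obtain \<chi> where \<chi>: "\<And>a. norm (\<chi> a) = 1" "\<And>i. i \<in> I \<Longrightarrow> \<theta> i = (\<Prod>a\<in>#v i. \<chi> a)"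
  proof (rule unit_equations_solvable[OF fin th])
    fix L L' assume h: "set L \<subseteq> I" "set L' \<subseteq> I" "sum_list (map v L) = sum_list (map v L')"
    have "mset (map X L) = mset (map X L')" "mset (map Y L) = mset (map Y L')" "mset (map Z L) = mset (map Z L')"
      using h(3) by (auto intro!: multiset_eqI simp flip: cnt simp del: mset_map)
    then show "lprod \<theta> L = lprod \<theta> L'" using found h not by blast
  qed auto
  have "embeddable I \<theta> X Y Z"
    unfolding embeddable_def
  proof (intro exI[of _ "\<lambda>x. cnj (\<chi> (Inl x))"] exI[of _ "\<lambda>y. cnj (\<chi> (Inr (Inl y)))"]
      exI[of _ "\<lambda>z. cnj (\<chi> (Inr (Inr z)))"] conjI ballI allI)
    fix i assume "i \<in> I"
    then have "\<theta> i = \<chi> (Inl (X i)) * \<chi> (Inr (Inl (Y i))) * \<chi> (Inr (Inr (Z i)))"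
      using \<chi>(2) by (simp add: v_def ac_simps)
    then have "cnj (\<chi> (Inl (X i))) * cnj (\<chi> (Inr (Inl (Y i)))) * cnj (\<chi> (Inr (Inr (Z i)))) * \<theta> i = cnj (\<theta> i) * \<theta> i"
      by simp
    then show "cnj (\<chi> (Inl (X i))) * cnj (\<chi> (Inr (Inl (Y i)))) * cnj (\<chi> (Inr (Inr (Z i)))) * \<theta> i = 1"
      using unit_cnj[OF th[OF \<open>i \<in> I\<close>]] by (simp add: mult.commute)
  qed (simp_all add: \<chi>)
  then show False using ne by simp
qed

text \<open>Greedy matching: each entry of \<open>L\<close> takes a remaining entry of
  \<open>L'\<close> with the same \<open>f\<close>-value.\<close>

lemma permute_to_match:
  assumes "mset (map f L) = mset (map f L')"
  shows "\<exists>K. mset K = mset L' \<and> map f K = map f L"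
  using assms
proof (induction L arbitrary: L')
  case Nil
  then show ?case by auto
next
  case (Cons x L)
  have "f x \<in> set (map f L')" using Cons.prems by (metis list.set_intros(1) list.simps(9) set_mset_mset)
  then obtain y where y: "y \<in> set L'" "f y = f x" by auto
  have "mset L' = add_mset y (mset (remove1 y L'))" using y by simp
  then have "image_mset f (mset L') = add_mset (f x) (image_mset f (mset (remove1 y L')))"
    using y by (metis image_mset_add_mset)
  then have "mset (map f L) = mset (map f (remove1 y L'))"
    using Cons.prems by simp
  then obtain K where "mset K = mset (remove1 y L')" "map f K = map f L" using Cons.IH by blast
  then show ?case using y by (intro exI[of _ "y # K"]) auto
qed

section \<open>Sorting by adjacent transpositions\<close>

definition adj_swap :: "('a list \<times> 'a list) set" where
  "adj_swap = {(u @ [p, q] @ v, u @ [q, p] @ v) | u p q v. True}"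

lemma adj_swap_Cons: "(xs, ys) \<in> adj_swap\<^sup>* \<Longrightarrow> (x # xs, x # ys) \<in> adj_swap\<^sup>*"
proof (induction rule: rtrancl_induct)
  case (step ys zs)
  then obtain u p q v where "ys = u @ [p, q] @ v" "zs = u @ [q, p] @ v" by (auto simp: adj_swap_def)
  then have "x # ys = (x # u) @ [p, q] @ v" "x # zs = (x # u) @ [q, p] @ v" by auto
  then have "(x # ys, x # zs) \<in> adj_swap" unfolding adj_swap_def by blast
  with step.IH show ?case by (rule rtrancl_into_rtrancl)
qed simp

lemma adj_swap_insert: "(x # us @ vs, us @ x # vs) \<in> adj_swap\<^sup>*"
proof (induction us)
  case (Cons u us)
  have "(x # u # us @ vs, u # x # us @ vs) \<in> adj_swap"
    unfolding adj_swap_def by (auto intro!: exI[of _ "[]"])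
  then show ?case using adj_swap_Cons[OF Cons.IH, of u] by (simp add: converse_rtrancl_into_rtrancl)
qed simp

text \<open>The tail is first turned into the target without \<open>x\<close>; then \<open>x\<close>
  moves to the right into its place.\<close>

lemma adj_swap_mset: "mset xs = mset ys \<Longrightarrow> (xs, ys) \<in> adj_swap\<^sup>*"
proof (induction xs arbitrary: ys)
  case (Cons x xs)
  have "x \<in> set ys" using Cons.prems by (metis list.set_intros(1) set_mset_mset)
  then obtain us vs where ys: "ys = us @ x # vs" by (auto simp: in_set_conv_decomp)
  then have "(xs, us @ vs) \<in> adj_swap\<^sup>*" using Cons by auto
  then have "(x # xs, x # us @ vs) \<in> adj_swap\<^sup>*" by (rule adj_swap_Cons)
  also have "(x # us @ vs, ys) \<in> adj_swap\<^sup>*" unfolding ys by (rule adj_swap_insert)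
  finally show ?case .
qed simp

section \<open>Closed walks\<close>

text \<open>Connectivity is expressed through edges, the elements of \<open>I\<close>, instead of
  vertices: edges are linked when they share an endpoint.\<close>

definition linked :: "'i set \<Rightarrow> ('i \<Rightarrow> 'p) \<Rightarrow> ('i \<Rightarrow> 'q) \<Rightarrow> ('i \<times> 'i) set" where
  "linked I P Q = {(i, j). i \<in> I \<and> j \<in> I \<and> (P i = P j \<or> Q i = Q j)}"

definition conn :: "'i set \<Rightarrow> ('i \<Rightarrow> 'p) \<Rightarrow> ('i \<Rightarrow> 'q) \<Rightarrow> bool" where
  "conn I P Q \<longleftrightarrow> (\<forall>i\<in>I. \<forall>j\<in>I. (i, j) \<in> (linked I P Q)\<^sup>*)"

lemma walk_appendI: "\<lbrakk>walk I E D u e m; walk I E D v m e'\<rbrakk> \<Longrightarrow> walk I E D (u @ v) e e'"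
  by (auto simp: walk_append)

text \<open>A link by a common \<open>Y\<close>-value costs no step, since walks run between
  \<open>Y\<close>-values; a link by a common \<open>X\<close>-value is one step.\<close>

lemma conn_walk:
  assumes "(i, j) \<in> (linked I X Y)\<^sup>*"
  shows "\<exists>w. walk I Y X w (Y i) (Y j)"
  using assms
proof (induction rule: rtrancl_induct)
  case base
  show ?case by (intro exI[of _ "[]"]) simp
next
  case (step j k)
  then obtain w where w: "walk I Y X w (Y i) (Y j)" by blast
  show ?case
  proof (cases "Y j = Y k")
    case True
    then show ?thesis using w by auto
  next
    case False
    then have "walk I Y X [(j, k)] (Y j) (Y k)" using step.hyps by (auto simp: linked_def)
    then show ?thesis using walk_appendI[OF w] by blast
  qed
qed

lemma lprod_mset_cong:
  fixes f :: "'i \<Rightarrow> 'm::comm_monoid_mult"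
  assumes "mset xs = mset ys"
  shows "lprod f xs = lprod f ys"
  using assms by (metis mset_map prod_mset_prod_list)

lemma sum_list_mset_cong:
  fixes f :: "'i \<Rightarrow> 'm::comm_monoid_add"
  assumes "mset xs = mset ys"
  shows "sum_list (map f xs) = sum_list (map f ys)"
  using assms by (metis mset_map sum_mset_sum_list)

text \<open>Two lists that witness nonembeddability are aligned so that paired entries share their
  \<open>X\<close>-value; each pair is then a step between \<open>Y\<close>-values, closed up by
  approach paths \<open>p\<close> from the base point. Both lists have the same
  \<open>Y\<close>-values, so the approach paths cancel in the phase and contribute equally to both
  sides of the letter count.\<close>

lemma closed_walk_exists:
  fixes X :: "'i \<Rightarrow> 'x" and Y :: "'i \<Rightarrow> 'y" and Z :: "'i \<Rightarrow> 'z"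
  assumes fin: "finite I" and th: "\<And>i. i \<in> I \<Longrightarrow> norm (\<theta> i) = 1" and ne: "\<not> embeddable I \<theta> X Y Z"
    and con: "conn I X Y" and i0: "i0 \<in> I"
  obtains w where "walk I Y X w (Y i0) (Y i0)" "mset (map (Z \<circ> fst) w) = mset (map (Z \<circ> snd) w)" "wph \<theta> w \<noteq> 1"
proof -
  obtain L L0 where L: "set L \<subseteq> I" "set L0 \<subseteq> I" "mset (map X L) = mset (map X L0)"
    "mset (map Y L) = mset (map Y L0)" "mset (map Z L) = mset (map Z L0)" "lprod \<theta> L \<noteq> lprod \<theta> L0"
    using not_embeddable_lists[OF fin th ne] by metis
  obtain L' where K: "mset L' = mset L0" "map X L' = map X L" using permute_to_match[OF L(3)] by blast
  have L': "set L' \<subseteq> I" "mset (map Y L) = mset (map Y L')" "mset (map Z L) = mset (map Z L')" "lprod \<theta> L \<noteq> lprod \<theta> L'"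
    using L K(1) lprod_mset_cong[OF K(1), of \<theta>] by (auto simp flip: set_mset_mset)
  have len: "length L = length L'" using K(2) by (metis length_map)
  have "\<forall>y\<in>Y ` I. \<exists>w. walk I Y X w (Y i0) y"
    using conn_walk[of i0 _ I X Y] con i0 by (auto simp: conn_def)
  from bchoice[OF this] obtain p where p: "\<And>y. y \<in> Y ` I \<Longrightarrow> walk I Y X (p y) (Y i0) y" by blast
  define g where "g = (\<lambda>(i, j). p (Y i) @ [(i, j)] @ wrev (p (Y j)))"
  define T where "T = zip L L'"
  define w where "w = concat (map g T)"
  have TI: "i \<in> I \<and> j \<in> I \<and> X i = X j" if ij: "(i, j) \<in> set T" for i j
  proof -
    obtain k where k: "k < length L" "i = L ! k" "j = L' ! k" using ij len by (auto simp: T_def set_zip)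
    have "X (L ! k) = X (L' ! k)" using K(2) k len by (metis nth_map)
    then show ?thesis using k L L' len by (auto simp: subset_iff)
  qed
  have gw: "walk I Y X (g t) (Y i0) (Y i0)" if "t \<in> set T" for t
  proof -
    obtain i j where t: "t = (i, j)" by (cases t)
    have ij: "i \<in> I" "j \<in> I" "X i = X j" using TI that t by auto
    have "walk I Y X [(i, j)] (Y i) (Y j)" using ij by simp
    moreover have "walk I Y X (wrev (p (Y j))) (Y j) (Y i0)" using p ij by (intro walk_wrev) auto
    moreover have "walk I Y X (p (Y i)) (Y i0) (Y i)" using p ij by auto
    ultimately show ?thesis unfolding g_def t prod.case by (intro walk_appendI)
  qed
  have "walk I Y X (concat (map g T')) (Y i0) (Y i0)" if "set T' \<subseteq> set T" for T'
    using that gw by (induction T') (auto intro: walk_appendI)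
  then have walk: "walk I Y X w (Y i0) (Y i0)" unfolding w_def by blast
  define A where "A y = wph \<theta> (p y)" for y
  have nA: "norm (A y) = 1" if "y \<in> Y ` I" for y unfolding A_def by (rule norm_wph[OF p[OF that] th])
  have mapT: "map fst T = L" "map snd T = L'" using len by (auto simp: T_def)
  have one: "wph \<theta> [(i, j)] = \<theta> i * cnj (\<theta> j)" for i j by (simp add: wph_def)
  have wg: "wph \<theta> (g t) = A (Y (fst t)) * \<theta> (fst t) * cnj (\<theta> (snd t)) * cnj (A (Y (snd t)))" for t
    by (cases t) (simp only: g_def prod.case wph_append one wph_wrev A_def fst_conv snd_conv mult.assoc)
  have "wph \<theta> w = lprod (wph \<theta>) (map g T)"
    unfolding w_def by (induction T) (auto simp: wph_append, simp add: wph_def)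
  also have "\<dots> = lprod (\<lambda>t. A (Y (fst t)) * \<theta> (fst t) * cnj (\<theta> (snd t)) * cnj (A (Y (snd t)))) T"
    unfolding map_map by (intro arg_cong[where f = prod_list] map_cong refl) (simp only: comp_apply wg)
  also have "\<dots> = lprod A (map Y (map fst T)) * lprod \<theta> (map fst T) * cnj (lprod \<theta> (map snd T)) * cnj (lprod A (map Y (map snd T)))"
    by (simp only: lprod_mult cnj_lprod map_map comp_def)
  also have "\<dots> = lprod A (map Y L) * lprod \<theta> L * cnj (lprod \<theta> L') * cnj (lprod A (map Y L'))"
    by (simp only: mapT)
  also have "lprod A (map Y L') = lprod A (map Y L)" by (rule lprod_mset_cong[OF L'(2)[symmetric]])
  also have "lprod A (map Y L) * lprod \<theta> L * cnj (lprod \<theta> L') * cnj (lprod A (map Y L))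
     = (lprod A (map Y L) * cnj (lprod A (map Y L))) * (lprod \<theta> L * cnj (lprod \<theta> L'))"
    by (simp only: ac_simps)
  also have "lprod A (map Y L) * cnj (lprod A (map Y L)) = 1"
  proof (rule unit_cnj)
    show "norm (lprod A (map Y L)) = 1"
      using L(1) nA by (induction L) (auto simp: norm_mult)
  qed
  finally have ph: "wph \<theta> w = lprod \<theta> L * cnj (lprod \<theta> L')" by simp
  have "wph \<theta> w \<noteq> 1"
  proof
    assume "wph \<theta> w = 1"
    have n': "norm (lprod \<theta> L') = 1" using L'(1) th by (induction L') (auto simp: norm_mult)
    have "lprod \<theta> L * (lprod \<theta> L' * cnj (lprod \<theta> L')) = lprod \<theta> L'"
      using \<open>wph \<theta> w = 1\<close> ph by (simp only: ac_simps) simp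
    then show False using L'(4) unit_cnj[OF n'] by simp
  qed
  moreover have "mset (map (Z \<circ> fst) w) = mset (map (Z \<circ> snd) w)"
  proof -
    \<comment> \<open>The multisets of letters read and written. Reversal exchanges them, so the
      return along \<open>p (Y j)\<close> reads what \<open>p (Y j)\<close> writes.\<close>
    define rd where "rd u = mset (map (Z \<circ> fst) u)" for u :: "('i \<times> 'i) list"
    define wr where "wr u = mset (map (Z \<circ> snd) u)" for u :: "('i \<times> 'i) list"
    have rw: "rd (wrev u) = wr u" "wr (wrev u) = rd u" for u
      by (simp_all add: rd_def wr_def wrev_def comp_def multiset.map_comp)
    have app: "rd (u @ v) = rd u + rd v" "wr (u @ v) = wr u + wr v" for u v by (simp_all add: rd_def wr_def)
    have one: "rd [(i, j)] = {#Z i#}" "wr [(i, j)] = {#Z j#}" for i j by (simp_all add: rd_def wr_def)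
    have cat: "rd (concat us) = sum_list (map rd us)" "wr (concat us) = sum_list (map wr us)" for us
      by (induction us) (simp_all add: app, simp_all add: rd_def wr_def)
    have ms: "mset xs = sum_list (map (\<lambda>x. {#x#}) xs)" for xs :: "'z list" by (induction xs) auto
    have rdw: "rd w = sum_list (map (\<lambda>t. rd (p (Y (fst t))) + {#Z (fst t)#} + wr (p (Y (snd t)))) T)"
      unfolding w_def cat map_map
      by (intro arg_cong[where f = sum_list] map_cong refl) (auto simp: g_def app(1) one rw simp del: append.simps)
    have wrw: "wr w = sum_list (map (\<lambda>t. wr (p (Y (fst t))) + {#Z (snd t)#} + rd (p (Y (snd t)))) T)"
      unfolding w_def cat map_map
      by (intro arg_cong[where f = sum_list] map_cong refl) (auto simp: g_def app(2) one rw simp del: append.simps)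
    have "rd w = sum_list (map (rd \<circ> p) (map Y (map fst T))) + mset (map Z (map fst T)) + sum_list (map (wr \<circ> p) (map Y (map snd T)))"
      unfolding rdw ms by (simp only: sum_list_addf map_map comp_def)
    also have "\<dots> = sum_list (map (rd \<circ> p) (map Y L)) + mset (map Z L) + sum_list (map (wr \<circ> p) (map Y L'))"
      by (simp only: mapT)
    also have "\<dots> = sum_list (map (rd \<circ> p) (map Y L')) + mset (map Z L') + sum_list (map (wr \<circ> p) (map Y L))"
      using sum_list_mset_cong[OF L'(2), of "rd \<circ> p"] sum_list_mset_cong[OF L'(2), of "wr \<circ> p"] L'(3) by (simp only:)
    also have "\<dots> = sum_list (map (wr \<circ> p) (map Y (map fst T))) + mset (map Z (map snd T)) + sum_list (map (rd \<circ> p) (map Y (map snd T)))"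
      by (simp only: mapT ac_simps)
    also have "\<dots> = wr w"
      unfolding wrw ms by (simp only: sum_list_addf map_map comp_def)
    finally show ?thesis by (simp add: rd_def wr_def)
  qed
  ultimately show ?thesis using that walk by blast
qed

text \<open>A state of the outer walk is a position, here always \<open>?o\<close>, with a word of
  length \<open>2 ^ a\<close>; a closed inner walk turns the word it reads into the word it writes.
  The walk \<open>c0\<close> of nontrivial phase permutes its word, transpositions of phase 1 undo
  the permutation, and the outer walk \<open>W\<close> so obtained is compared with
  \<open>W'\<close>, which only copies.\<close>

lemma decay_full:
  fixes X :: "'i \<Rightarrow> 'x" and Y :: "'i \<Rightarrow> 'y" and Z :: "'i \<Rightarrow> 'z"
  assumes P: "prob_on I P" and th: "\<And>i. i \<in> I \<Longrightarrow> norm (\<theta> i) = 1" and ne: "\<not> embeddable I \<theta> X Y Z"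
    and con: "conn I X Y"
    and hub: "i0 \<in> I" "\<And>j. j \<in> I \<Longrightarrow> \<exists>k\<in>I. Y k = Y i0 \<and> Z k = Z j"
    and full: "\<And>i j. \<lbrakk>i \<in> I; j \<in> I\<rbrakk> \<Longrightarrow> \<exists>k\<in>I. X k = X i \<and> Z k = Z j"
  shows "decay I P \<theta> X Y Z"
proof -
  have fin: "finite I" using P by (simp add: prob_on_def)
  obtain w where w: "walk I Y X w (Y i0) (Y i0)" "mset (map (Z \<circ> fst) w) = mset (map (Z \<circ> snd) w)" "wph \<theta> w \<noteq> 1"
    using closed_walk_exists[OF fin th ne con hub(1)] by metis
  \<comment> \<open>Lengths have to be powers of 2; \<open>2 ^ a\<close> is at least the length of
    \<open>w\<close>, and the remaining time is spent at the base point.\<close>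
  define a where "a = length w"
  have la: "length w \<le> 2 ^ a" unfolding a_def by (rule less_imp_le[OF less_exp])
  define C where "C = walks I Y X (2 ^ a)"
  define U where "U c = (wstart Y c, map (Z \<circ> fst) c)" for c
  define R where "R c = (wend Y c, map (Z \<circ> snd) c)" for c
  let ?o = "Y i0"
  have C: "c \<in> C" "U c = (?o, map (Z \<circ> fst) c)" "R c = (?o, map (Z \<circ> snd) c)"
    if "walk I Y X c ?o ?o" "length c = 2 ^ a" for c
  proof -
    have "c \<noteq> []" using that by auto
    then have "wstart Y c = ?o" "wend Y c = ?o" using walk_ends[OF that(1)] by auto
    then show "c \<in> C" "U c = (?o, map (Z \<circ> fst) c)" "R c = (?o, map (Z \<circ> snd) c)"
      using that by (auto simp: C_def walks_def U_def R_def)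
  qed
  \<comment> \<open>\<open>\<kappa> z\<close> is an edge from the hub to the letter
    \<open>z\<close>; the step that uses it twice stays at \<open>?o\<close> and copies
    \<open>z\<close>.\<close>
  have "\<forall>z\<in>Z ` I. \<exists>k. k \<in> I \<and> Y k = ?o \<and> Z k = z" using hub(2) by auto
  from bchoice[OF this] obtain \<kappa> where \<kappa>: "\<And>z. z \<in> Z ` I \<Longrightarrow> \<kappa> z \<in> I \<and> Y (\<kappa> z) = ?o \<and> Z (\<kappa> z) = z"
    by blast
  define lz where "lz zs = map (\<lambda>z. (\<kappa> z, \<kappa> z)) zs" for zs
  have lz: "walk I Y X (lz zs) ?o ?o" "map (Z \<circ> fst) (lz zs) = zs" "map (Z \<circ> snd) (lz zs) = zs" "wph \<theta> (lz zs) = 1"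
    if "set zs \<subseteq> Z ` I" for zs
    using that \<kappa> th by (induction zs) (auto simp: lz_def wph_def unit_cnj)
  have len_lz: "length (lz zs) = length zs" for zs by (simp add: lz_def)
  define good where "good zs \<longleftrightarrow> set zs \<subseteq> Z ` I \<and> length zs = 2 ^ a" for zs
  have lzC: "lz zs \<in> C" "U (lz zs) = (?o, zs)" "R (lz zs) = (?o, zs)" "wph \<theta> (lz zs) = 1" if "good zs" for zs
    using C[of "lz zs"] lz[of zs] len_lz[of zs] that by (auto simp: good_def)
  \<comment> \<open>An outer step pairs \<open>c\<close> with an inner walk of the same output. The
    copying walk \<open>lz zs\<close> has that output and also the same input, so the step leads to
    \<open>(?o, zs)\<close> with the phase of \<open>c\<close>.\<close>
  have step: "walk C U R [(c, lz zs)] (U c) (?o, zs) \<and> wph (wph \<theta>) [(c, lz zs)] = wph \<theta> c"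
    if "good zs" "c \<in> C" "R c = (?o, zs)" for c zs
    using that lzC[OF that(1)] by (simp add: wph_def)
  have swap: "\<exists>V. walk C U R V (?o, zs) (?o, zs') \<and> wph (wph \<theta>) V = 1"
    if sw: "(zs, zs') \<in> adj_swap" "good zs" for zs zs'
  proof -
    obtain u p q v where uv: "zs = u @ [p, q] @ v" "zs' = u @ [q, p] @ v" using sw by (auto simp: adj_swap_def)
    have g: "good zs'" "set u \<subseteq> Z ` I" "set v \<subseteq> Z ` I" "p \<in> Z ` I" "q \<in> Z ` I" "length u + 2 + length v = 2 ^ a"
      using sw uv by (auto simp: good_def)
    \<comment> \<open>An edge \<open>j\<close> with letter \<open>q\<close> at the
      \<open>X\<close>-label of \<open>\<kappa> p\<close>. Going out by \<open>\<kappa> p\<close>,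
      \<open>j\<close> and returning by \<open>j\<close>, \<open>\<kappa> p\<close> reads
      \<open>p\<close>, \<open>q\<close>, writes \<open>q\<close>, \<open>p\<close>, and the phases
      cancel.\<close>
    obtain j where j: "j \<in> I" "X j = X (\<kappa> p)" "Z j = q" using full[of "\<kappa> p"] \<kappa>[OF g(4)] g(5) by blast
    define c where "c = lz u @ [(\<kappa> p, j), (j, \<kappa> p)] @ lz v"
    have "walk I Y X [(\<kappa> p, j), (j, \<kappa> p)] ?o ?o" using j \<kappa>[OF g(4)] by simp
    then have "walk I Y X c ?o ?o"
      unfolding c_def by (rule walk_appendI[OF lz(1)[OF g(2)] walk_appendI[OF _ lz(1)[OF g(3)]]])
    moreover have "length c = 2 ^ a" using g by (simp add: c_def len_lz)
    moreover have "map (Z \<circ> fst) c = zs" "map (Z \<circ> snd) c = zs'"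
      using lz(2,3)[OF g(2)] lz(2,3)[OF g(3)] j \<kappa>[OF g(4)] uv by (simp_all add: c_def)
    moreover have "wph \<theta> c = 1"
    proof -
      have "wph \<theta> [(\<kappa> p, j), (j, \<kappa> p)] = (\<theta> (\<kappa> p) * cnj (\<theta> (\<kappa> p))) * (\<theta> j * cnj (\<theta> j))"
        by (simp add: wph_def)
      also have "\<dots> = 1" using unit_cnj th j \<kappa>[OF g(4)] by simp
      finally show ?thesis unfolding c_def wph_append using lz(4)[OF g(2)] lz(4)[OF g(3)] by simp
    qed
    ultimately show ?thesis using step[OF g(1), of c] C[of c] by (intro exI[of _ "[(c, lz zs')]"]) simp
  qed
  have swaps: "\<exists>V. walk C U R V (?o, zs) (?o, zs') \<and> wph (wph \<theta>) V = 1"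
    if "(zs, zs') \<in> adj_swap\<^sup>*" "good zs" for zs zs'
  proof -
    have "good zs' \<and> (\<exists>V. walk C U R V (?o, zs) (?o, zs') \<and> wph (wph \<theta>) V = 1)"
      using that
    proof (induction rule: rtrancl_induct)
      case base
      then show ?case by (auto intro!: exI[of _ "[]"] simp: wph_def)
    next
      case (step y z)
      then obtain V V' where V: "walk C U R V (?o, zs) (?o, y)" "wph (wph \<theta>) V = 1"
        "walk C U R V' (?o, y) (?o, z)" "wph (wph \<theta>) V' = 1" using swap by blast
      moreover have "good z" using step by (auto simp: good_def adj_swap_def)
      ultimately show ?case
        by (intro conjI exI[of _ "V @ V'"]) (auto intro: walk_appendI simp: wph_append)
    qed
    then show ?thesis by blast
  qed
  define c0 where "c0 = w @ replicate (2 ^ a - length w) (i0, i0)"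
  have rep: "walk I Y X (replicate k (i0, i0)) ?o ?o" "wph \<theta> (replicate k (i0, i0)) = 1" for k
    using hub(1) unit_cnj[OF th[OF hub(1)]] by (induction k) (auto simp: wph_def)
  have c0: "walk I Y X c0 ?o ?o" "length c0 = 2 ^ a" "wph \<theta> c0 \<noteq> 1"
    "mset (map (Z \<circ> fst) c0) = mset (map (Z \<circ> snd) c0)"
    using w rep la by (auto simp: c0_def wph_append intro: walk_appendI)
  define r where "r = map (Z \<circ> fst) c0"
  define s where "s = map (Z \<circ> snd) c0"
  have good: "good r" "good s"
    using walk_set[OF c0(1)] c0(2) unfolding good_def r_def s_def by auto
  have "mset s = mset r" using c0(4) by (simp add: r_def s_def)
  then obtain V where V: "walk C U R V (?o, s) (?o, r)" "wph (wph \<theta>) V = 1"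
    using swaps[OF adj_swap_mset good(2)] by blast
  have "walk C U R [(c0, lz s)] (?o, r) (?o, s) \<and> wph (wph \<theta>) [(c0, lz s)] = wph \<theta> c0"
    using step[OF good(2), of c0] C[OF c0(1,2)] by (simp add: r_def s_def)
  then have c1: "walk C U R [(c0, lz s)] (?o, r) (?o, s)" "wph (wph \<theta>) [(c0, lz s)] = wph \<theta> c0" by blast+
  have W0: "walk C U R ([(c0, lz s)] @ V) (?o, r) (?o, r)" by (rule walk_appendI[OF c1(1) V(1)])
  have W1: "wph (wph \<theta>) ([(c0, lz s)] @ V) \<noteq> 1"
    using c0(3) by (simp only: wph_append c1(2) V(2) mult_1_right not_False_eq_True)
  define b where "b = length ([(c0, lz s)] @ V)"
  have lb: "length ([(c0, lz s)] @ V) \<le> 2 ^ b" unfolding b_def by (rule less_imp_le[OF less_exp])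
  have lazy: "walk C U R (replicate k (lz r, lz r)) (?o, r) (?o, r)" "wph (wph \<theta>) (replicate k (lz r, lz r)) = 1" for k
    using lzC[OF good(1)] by (induction k) (auto simp: wph_def)
  define W where "W = ([(c0, lz s)] @ V) @ replicate (2 ^ b - length ([(c0, lz s)] @ V)) (lz r, lz r)"
  define W' where "W' = replicate (2 ^ b) (lz r, lz r)"
  have W: "walk C U R W (?o, r) (?o, r)" "length W = 2 ^ b" "wph (wph \<theta>) W \<noteq> 1"
    using W1 lb lazy(2) walk_appendI[OF W0 lazy(1)]
    unfolding W_def by (simp_all only: wph_append length_append length_replicate mult_1_right le_add_diff_inverse not_False_eq_True)
  have W': "walk C U R W' (?o, r) (?o, r)" "length W' = 2 ^ b" "wph (wph \<theta>) W' = 1"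
    using lazy unfolding W'_def by auto
  have ne: "W \<noteq> []" "W' \<noteq> []" using W(2) W'(2) by auto
  have "W \<in> walks C U R (2 ^ b)" "W' \<in> walks C U R (2 ^ b)" using W W' by (auto simp: walks_def)
  moreover have "wstart U W = wstart U W'" "wend U W = wend U W'"
    using walk_ends[OF W(1) ne(1)] walk_ends[OF W'(1) ne(2)] by auto
  moreover have "wph (wph \<theta>) W \<noteq> wph (wph \<theta>) W'" using W W' by simp
  ultimately show ?thesis
    unfolding C_def U_def R_def by (intro decay_of_walks[OF P th])
qed

section \<open>Reduction to full adjacency\<close>

text \<open>The properties that the path trick preserves, collected so that it can be
  iterated.\<close>

definition game :: "'i set \<Rightarrow> ('i \<Rightarrow> real) \<Rightarrow> ('i \<Rightarrow> complex) \<Rightarrow> ('i \<Rightarrow> 'x) \<Rightarrow> ('i \<Rightarrow> 'y) \<Rightarrow> ('i \<Rightarrow> 'z) \<Rightarrow> bool" where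
  "game I P \<theta> X Y Z \<longleftrightarrow> prob_on I P \<and> (\<forall>i\<in>I. norm (\<theta> i) = 1) \<and> \<not> embeddable I \<theta> X Y Z \<and>
     conn I X Y \<and> conn I X Z \<and> conn I Y Z"

lemma linked_commute: "linked I Q P = linked I P Q"
  by (auto simp: linked_def)

lemma conn_commute: "conn I Q P \<longleftrightarrow> conn I P Q"
  by (simp add: conn_def linked_commute[of I Q P])

lemma game_swap:
  assumes "game I P \<theta> X Y Z"
  shows "game I P \<theta> Y X Z"
proof -
  have "embeddable I \<theta> X Y Z" if emb: "embeddable I \<theta> Y X Z"
  proof -
    obtain A B C where "\<forall>y. norm (A y) = 1" "\<forall>x. norm (B x) = 1" "\<forall>z. norm (C z) = 1"
      "\<forall>i\<in>I. A (Y i) * B (X i) * C (Z i) * \<theta> i = 1" using emb unfolding embeddable_def by blast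
    then show ?thesis unfolding embeddable_def
      by (intro exI[of _ B] exI[of _ A] exI[of _ C]) (simp add: mult.commute[of "B _"])
  qed
  moreover have "conn I Y X" using assms conn_commute[of I Y X] by (simp add: game_def)
  ultimately show ?thesis using assms unfolding game_def by blast
qed

text \<open>A chain of links in \<open>I\<close> is mapped to one in \<open>J\<close>, and
  \<open>near\<close> supplies the first and the last link.\<close>

lemma conn_transfer:
  assumes con: "conn I P Q" and f: "\<And>i. i \<in> I \<Longrightarrow> f i \<in> J"
    and P: "\<And>i j. \<lbrakk>i \<in> I; j \<in> I; P i = P j\<rbrakk> \<Longrightarrow> P' (f i) = P' (f j)"
    and Q: "\<And>i j. \<lbrakk>i \<in> I; j \<in> I; Q i = Q j\<rbrakk> \<Longrightarrow> Q' (f i) = Q' (f j)"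
    and near: "\<And>j. j \<in> J \<Longrightarrow> \<exists>i\<in>I. P' (f i) = P' j \<or> Q' (f i) = Q' j"
  shows "conn J P' Q'"
  unfolding conn_def
proof (intro ballI)
  fix j j' assume j: "j \<in> J" "j' \<in> J"
  obtain i where i: "i \<in> I" "P' (f i) = P' j \<or> Q' (f i) = Q' j" using near j by blast
  obtain i' where i': "i' \<in> I" "P' (f i') = P' j' \<or> Q' (f i') = Q' j'" using near j by blast
  have "(i, i') \<in> (linked I P Q)\<^sup>*" using con i i' by (simp add: conn_def)
  then have "(f i, f i') \<in> (linked J P' Q')\<^sup>*"
  proof (induction rule: rtrancl_induct)
    case (step k l)
    then have "(f k, f l) \<in> linked J P' Q'" using P Q f by (auto simp: linked_def)
    with step.IH show ?case by (rule rtrancl_into_rtrancl)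
  qed simp
  moreover have "(j, f i) \<in> linked J P' Q'" "(f i', j') \<in> linked J P' Q'"
    using i i' j f by (auto simp: linked_def)
  ultimately show "(j, j') \<in> (linked J P' Q')\<^sup>*"
    by (meson converse_rtrancl_into_rtrancl rtrancl_into_rtrancl)
qed

lemma conn_relabel:
  assumes "conn J S T" "inj f"
  shows "conn (f ` J) (p \<circ> S \<circ> inv f) (q \<circ> T \<circ> inv f)"
  by (rule conn_transfer[OF assms(1), where f = f]) (use assms(2) in auto)

lemma game_relabel:
  assumes G: "game J P \<theta> X Y Z" and f: "inj f" and abc: "inj a" "inj b" "inj c"
  shows "game (f ` J) (P \<circ> inv f) (\<theta> \<circ> inv f) (a \<circ> X \<circ> inv f) (b \<circ> Y \<circ> inv f) (c \<circ> Z \<circ> inv f)"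
proof -
  have inv: "inv f (f j) = j" for j using f by simp
  have "prob_on (f ` J) (P \<circ> inv f)"
    using G f by (auto simp: game_def prob_on_def inv sum.reindex inj_on_subset[OF f])
  moreover have "embeddable J \<theta> X Y Z" if emb: "embeddable (f ` J) (\<theta> \<circ> inv f) (a \<circ> X \<circ> inv f) (b \<circ> Y \<circ> inv f) (c \<circ> Z \<circ> inv f)"
  proof -
    obtain A B C where "\<forall>y. norm (A y) = 1" "\<forall>x. norm (B x) = 1" "\<forall>z. norm (C z) = 1"
      "\<forall>j\<in>J. A (a (X j)) * B (b (Y j)) * C (c (Z j)) * \<theta> j = 1" using emb unfolding embeddable_def by (auto simp: inv)
    then show ?thesis unfolding embeddable_def
      by (intro exI[of _ "A \<circ> a"] exI[of _ "B \<circ> b"] exI[of _ "C \<circ> c"]) simp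
  qed
  moreover have "conn (f ` J) (a \<circ> X \<circ> inv f) (b \<circ> Y \<circ> inv f)"
    by (rule conn_relabel[OF _ f]) (use G in \<open>simp add: game_def\<close>)
  moreover have "conn (f ` J) (a \<circ> X \<circ> inv f) (c \<circ> Z \<circ> inv f)"
    by (rule conn_relabel[OF _ f]) (use G in \<open>simp add: game_def\<close>)
  moreover have "conn (f ` J) (b \<circ> Y \<circ> inv f) (c \<circ> Z \<circ> inv f)"
    by (rule conn_relabel[OF _ f]) (use G in \<open>simp add: game_def\<close>)
  moreover have "\<forall>i\<in>f ` J. norm ((\<theta> \<circ> inv f) i) = 1" "\<not> embeddable J \<theta> X Y Z"
    using G by (simp_all add: game_def inv)
  ultimately show ?thesis unfolding game_def by blast
qed

text \<open>Constant triples contain the original game, so an embedding restricts to the diagonal.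
  Each path shares its first \<open>Y\<close>-label with one constant triple and its last
  \<open>Z\<close>-label with another, which transfers connectivity.\<close>

lemma game_path:
  assumes G: "game I P \<theta> X Y Z"
  shows "game (path_set I Y Z) (path_wt I P Y Z) (path_ph \<theta>) (map3 X) (Y \<circ> fst3) (Z \<circ> trd3)"
proof -
  let ?J = "path_set I Y Z" and ?d = "\<lambda>i. (i, i, i)"
  have d: "?d i \<in> ?J" if "i \<in> I" for i using that by (simp add: path_set_def)
  have near: "fst3 j \<in> I" "trd3 j \<in> I" if "j \<in> ?J" for j using that by (auto simp: path_set_def proj3)
  have "embeddable I \<theta> X Y Z" if emb: "embeddable ?J (path_ph \<theta>) (map3 X) (Y \<circ> fst3) (Z \<circ> trd3)"
  proof -
    obtain A B C where ABC: "\<forall>y. norm (A y) = 1" "\<forall>x. norm (B x) = 1" "\<forall>z. norm (C z) = 1"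
      "\<And>j. j \<in> ?J \<Longrightarrow> A (map3 X j) * B ((Y \<circ> fst3) j) * C ((Z \<circ> trd3) j) * path_ph \<theta> j = 1"
      using emb unfolding embeddable_def by blast
    have "A (X i, X i, X i) * B (Y i) * C (Z i) * \<theta> i = 1" if "i \<in> I" for i
    proof -
      have "\<theta> i * cnj (\<theta> i) = 1" using that G by (simp add: game_def unit_cnj)
      then show ?thesis using ABC(4)[OF d[OF that]] by (simp add: map3_def proj3 path_ph_def)
    qed
    then show ?thesis unfolding embeddable_def using ABC
      by (intro exI[of _ "\<lambda>x. A (x, x, x)"] exI[of _ B] exI[of _ C]) simp
  qed
  moreover have "conn ?J (map3 X) (Y \<circ> fst3)"
  proof (rule conn_transfer[where f = ?d and I = I and P = X and Q = Y])
    show "\<exists>i\<in>I. map3 X (i, i, i) = map3 X j \<or> (Y \<circ> fst3) (i, i, i) = (Y \<circ> fst3) j" if "j \<in> ?J" for j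
      using near[OF that] by (intro bexI[of _ "fst3 j"]) (auto simp: proj3)
  qed (use G d in \<open>auto simp: game_def map3_def proj3\<close>)
  moreover have "conn ?J (map3 X) (Z \<circ> trd3)"
  proof (rule conn_transfer[where f = ?d and I = I and P = X and Q = Z])
    show "\<exists>i\<in>I. map3 X (i, i, i) = map3 X j \<or> (Z \<circ> trd3) (i, i, i) = (Z \<circ> trd3) j" if "j \<in> ?J" for j
      using near[OF that] by (intro bexI[of _ "trd3 j"]) (auto simp: proj3)
  qed (use G d in \<open>auto simp: game_def map3_def proj3\<close>)
  moreover have "conn ?J (Y \<circ> fst3) (Z \<circ> trd3)"
  proof (rule conn_transfer[where f = ?d and I = I and P = Y and Q = Z])
    show "\<exists>i\<in>I. (Y \<circ> fst3) (i, i, i) = (Y \<circ> fst3) j \<or> (Z \<circ> trd3) (i, i, i) = (Z \<circ> trd3) j" if "j \<in> ?J" for j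
      using near[OF that] by (intro bexI[of _ "fst3 j"]) (auto simp: proj3)
  qed (use G d in \<open>auto simp: game_def proj3\<close>)
  moreover have "\<forall>j\<in>?J. norm (path_ph \<theta> j) = 1"
    using G by (auto simp: game_def path_set_def path_ph_def norm_mult)
  moreover have "prob_on ?J (path_wt I P Y Z)" "\<not> embeddable I \<theta> X Y Z"
    using G by (simp_all add: game_def prob_on_path)
  ultimately show ?thesis unfolding game_def by blast
qed

definition full :: "'i set \<Rightarrow> ('i \<Rightarrow> 'y) \<Rightarrow> ('i \<Rightarrow> 'z) \<Rightarrow> bool" where
  "full I Y Z \<longleftrightarrow> (\<forall>i\<in>I. \<forall>j\<in>I. \<exists>k\<in>I. Y k = Y i \<and> Z k = Z j)"

definition hub :: "'i set \<Rightarrow> ('i \<Rightarrow> 'y) \<Rightarrow> ('i \<Rightarrow> 'z) \<Rightarrow> bool" where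
  "hub I Y Z \<longleftrightarrow> (\<exists>i0\<in>I. \<forall>j\<in>I. \<exists>k\<in>I. Y k = Y i0 \<and> Z k = Z j)"

text \<open>Along a chain of edges from \<open>i\<close> to \<open>j\<close>, adjacency of
  \<open>Y i\<close> to the \<open>Z\<close>-label of one edge passes to the next: where the
  \<open>Z\<close>-label changes, the three edges involved form a path, to which \<open>cl\<close>
  applies.\<close>

lemma full_of_path_closed:
  assumes con: "conn I Y Z"
    and cl: "\<And>t. t \<in> path_set I Y Z \<Longrightarrow> \<exists>k\<in>I. Y k = Y (fst3 t) \<and> Z k = Z (trd3 t)"
  shows "full I Y Z"
  unfolding full_def
proof (intro ballI)
  fix i j assume ij: "i \<in> I" "j \<in> I"
  then have "(i, j) \<in> (linked I Y Z)\<^sup>*" using con by (simp add: conn_def)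
  then show "\<exists>k\<in>I. Y k = Y i \<and> Z k = Z j"
  proof (induction rule: rtrancl_induct)
    case base
    then show ?case using ij by blast
  next
    case (step j j')
    then obtain k where k: "k \<in> I" "Y k = Y i" "Z k = Z j" by blast
    have jj: "j \<in> I" "j' \<in> I" "Y j = Y j' \<or> Z j = Z j'" using step.hyps by (auto simp: linked_def)
    show ?case
    proof (cases "Z j = Z j'")
      case True
      then show ?thesis using k by auto
    next
      case False
      then have "(k, j, j') \<in> path_set I Y Z" using k jj by (auto simp: path_set_def)
      from cl[OF this] show ?thesis using k by (simp add: proj3)
    qed
  qed
qed

text \<open>Triples are coded as numbers again, so that the types stay the same from one round of
  the path trick to the next.\<close>

definition enc3 :: "nat \<times> nat \<times> nat \<Rightarrow> nat" where
  "enc3 = (\<lambda>(i, j, k). prod_encode (i, prod_encode (j, k)))"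

lemma inj_enc3: "inj enc3"
  by (auto simp: enc3_def inj_def)

text \<open>Induction on the number of non-adjacent pairs of a \<open>Y\<close>-value and a
  \<open>Z\<close>-value. As long as one exists, some path has non-adjacent ends; the path trick
  joins the ends of all paths and keeps both sets of values. The flag \<open>h\<close> tells whether
  a hub for \<open>X\<close> and \<open>Z\<close> is carried along.\<close>

lemma reduce_to_full:
  fixes X Y Z :: "nat \<Rightarrow> nat"
  assumes base: "\<And>I P \<theta> (X :: nat \<Rightarrow> nat) (Y :: nat \<Rightarrow> nat) (Z :: nat \<Rightarrow> nat).
       \<lbrakk>game I P \<theta> X Y Z; h \<Longrightarrow> hub I X Z; full I Y Z\<rbrakk> \<Longrightarrow> decay I P \<theta> X Y Z"
    and "game I P \<theta> X Y Z" "h \<Longrightarrow> hub I X Z"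
  shows "decay I P \<theta> X Y Z"
  using assms(2,3)
proof (induction "card (Y ` I \<times> Z ` I) - card ((\<lambda>i. (Y i, Z i)) ` I)" arbitrary: I P \<theta> X Y Z rule: less_induct)
  case less
  show ?case
  proof (cases "full I Y Z")
    case True
    show ?thesis by (rule base[OF less.prems True])
  next
    case False
    have P: "prob_on I P" and th: "\<And>i. i \<in> I \<Longrightarrow> norm (\<theta> i) = 1" and con: "conn I Y Z"
      using less.prems(1) by (auto simp: game_def)
    have fin: "finite I" using P by (simp add: prob_on_def)
    obtain t where t: "t \<in> path_set I Y Z" "\<not> (\<exists>k\<in>I. Y k = Y (fst3 t) \<and> Z k = Z (trd3 t))"
      using full_of_path_closed[OF con] False by blast
    let ?J = "path_set I Y Z"
    let ?dec = "inv enc3"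
    let ?I = "enc3 ` ?J" and ?P = "path_wt I P Y Z \<circ> ?dec" and ?\<theta> = "path_ph \<theta> \<circ> ?dec"
      and ?X = "enc3 \<circ> map3 X \<circ> ?dec" and ?Y = "id \<circ> (Y \<circ> fst3) \<circ> ?dec" and ?Z = "id \<circ> (Z \<circ> trd3) \<circ> ?dec"
    have dec: "?dec (enc3 t) = t" for t using inj_enc3 by simp
    have G: "game ?I ?P ?\<theta> ?X ?Y ?Z"
      by (intro game_relabel game_path less.prems inj_enc3 inj_on_id)
    have in3: "fst3 s \<in> I" "trd3 s \<in> I" if "s \<in> ?J" for s using that by (auto simp: path_set_def proj3)
    have d: "(i, i, i) \<in> ?J" if "i \<in> I" for i using that by (simp add: path_set_def)
    have H: "hub ?I ?X ?Z" if hh: "h"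
    proof -
      obtain i0 where i0: "i0 \<in> I" "\<And>j. j \<in> I \<Longrightarrow> \<exists>k\<in>I. X k = X i0 \<and> Z k = Z j"
        using less.prems(2)[OF hh] unfolding hub_def by blast
      \<comment> \<open>The constant triple of the old hub label is the new hub; constant paths join
        it to every \<open>Z\<close>-value.\<close>
      show ?thesis unfolding hub_def
      proof (rule bexI[of _ "enc3 (i0, i0, i0)"])
        show "\<forall>j\<in>?I. \<exists>k\<in>?I. ?X k = ?X (enc3 (i0, i0, i0)) \<and> ?Z k = ?Z j"
        proof
          fix j assume "j \<in> ?I"
          then obtain s where s: "s \<in> ?J" "j = enc3 s" by blast
          obtain k where k: "k \<in> I" "X k = X i0" "Z k = Z (trd3 s)" using i0(2)[OF in3(2)[OF s(1)]] by blast
          have "enc3 (k, k, k) \<in> ?I" using d[OF k(1)] by blast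
          moreover have "?X (enc3 (k, k, k)) = ?X (enc3 (i0, i0, i0))" "?Z (enc3 (k, k, k)) = ?Z j"
            using k s(2) by (simp_all add: dec map3_def proj3)
          ultimately show "\<exists>k\<in>?I. ?X k = ?X (enc3 (i0, i0, i0)) \<and> ?Z k = ?Z j" by blast
        qed
        show "enc3 (i0, i0, i0) \<in> ?I" using d[OF i0(1)] by blast
      qed
    qed
    have Yim: "?Y ` ?I = Y ` I"
    proof
      show "?Y ` ?I \<subseteq> Y ` I" using in3 by (auto simp: dec)
      show "Y ` I \<subseteq> ?Y ` ?I"
      proof
        fix y assume "y \<in> Y ` I"
        then obtain i where "i \<in> I" "y = Y i" by blast
        then show "y \<in> ?Y ` ?I" using d by (intro image_eqI[of _ _ "enc3 (i, i, i)"]) (auto simp: dec proj3)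
      qed
    qed
    have Zim: "?Z ` ?I = Z ` I"
    proof
      show "?Z ` ?I \<subseteq> Z ` I" using in3 by (auto simp: dec)
      show "Z ` I \<subseteq> ?Z ` ?I"
      proof
        fix y assume "y \<in> Z ` I"
        then obtain i where "i \<in> I" "y = Z i" by blast
        then show "y \<in> ?Z ` ?I" using d by (intro image_eqI[of _ _ "enc3 (i, i, i)"]) (auto simp: dec proj3)
      qed
    qed
    let ?A = "(\<lambda>i. (Y i, Z i)) ` I" and ?B = "(\<lambda>i. (?Y i, ?Z i)) ` ?I"
    have "?A \<subseteq> ?B"
    proof
      fix y assume "y \<in> ?A"
      then obtain i where "i \<in> I" "y = (Y i, Z i)" by blast
      then show "y \<in> ?B" using d by (intro image_eqI[of _ _ "enc3 (i, i, i)"]) (auto simp: dec proj3)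
    qed
    moreover have "(Y (fst3 t), Z (trd3 t)) \<in> ?B"
      using t(1) by (intro image_eqI[of _ _ "enc3 t"]) (auto simp: dec)
    moreover have "(Y (fst3 t), Z (trd3 t)) \<notin> ?A" using t(2) by auto
    ultimately have sub: "?A \<subset> ?B" by blast
    have finB: "finite (Y ` I \<times> Z ` I)" using fin by simp
    have B: "?B \<subseteq> Y ` I \<times> Z ` I" using Yim Zim by blast
    have "card ?A < card ?B" using sub finite_subset[OF B finB] by (rule psubset_card_mono[rotated])
    moreover have "card ?B \<le> card (Y ` I \<times> Z ` I)" by (rule card_mono[OF finB B])
    ultimately have "card (?Y ` ?I \<times> ?Z ` ?I) - card ?B < card (Y ` I \<times> Z ` I) - card ?A"
      unfolding Yim Zim by linarith
    then have "decay ?I ?P ?\<theta> ?X ?Y ?Z" by (rule less.hyps[OF _ G H])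
    then have "decay ?J (path_wt I P Y Z) (path_ph \<theta>) (map3 X) (Y \<circ> fst3) (Z \<circ> trd3)"
    proof (rule decay_relabel[rotated -1, where f = enc3 and a = enc3 and b = id and c = id])
      show "bij_betw enc3 ?J ?I" by (rule bij_betw_imageI) (auto intro: inj_on_subset[OF inj_enc3])
    qed (auto simp: dec inj_enc3)
    then show ?thesis by (rule decay_path[OF P th, rotated])
  qed
qed

text \<open>The first reduction makes all pairs of \<open>Y\<close>- and \<open>Z\<close>-values
  adjacent, so every \<open>Y\<close>-value is a hub. The second, with \<open>X\<close> and
  \<open>Y\<close> exchanged, completes the pairs of \<open>X\<close>- and \<open>Z\<close>-values
  while a hub among the \<open>Y\<close>-labels survives. This is the situation of
  \<open>decay_full\<close>.\<close>

lemma game_decay: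
  fixes X Y Z :: "nat \<Rightarrow> nat"
  assumes "game I P \<theta> X Y Z"
  shows "decay I P \<theta> X Y Z"
proof (rule reduce_to_full[where h = False])
  fix I P \<theta> and X Y Z :: "nat \<Rightarrow> nat"
  assume G: "game I P \<theta> X Y Z" and F: "full I Y Z"
  have "I \<noteq> {}" using G by (auto simp: game_def prob_on_def)
  then have "hub I Y Z" using F unfolding full_def hub_def by blast
  have "decay I P \<theta> Y X Z"
  proof (rule reduce_to_full[where h = True])
    fix I P \<theta> and Y X Z :: "nat \<Rightarrow> nat"
    assume G: "game I P \<theta> Y X Z" and H: "True \<Longrightarrow> hub I Y Z" and F: "full I X Z"
    obtain i0 where i0: "i0 \<in> I" "\<And>j. j \<in> I \<Longrightarrow> \<exists>k\<in>I. Y k = Y i0 \<and> Z k = Z j"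
      using H unfolding hub_def by blast
    have G': "prob_on I P" "\<And>i. i \<in> I \<Longrightarrow> norm (\<theta> i) = 1" "\<not> embeddable I \<theta> X Y Z" "conn I X Y"
      using game_swap[OF G] by (auto simp: game_def)
    have F': "\<exists>k\<in>I. X k = X i \<and> Z k = Z j" if "i \<in> I" "j \<in> I" for i j
      using F that by (simp add: full_def)
    show "decay I P \<theta> Y X Z" by (rule decay_swap[OF decay_full[OF G' i0 F']])
  next
    show "game I P \<theta> Y X Z" by (rule game_swap[OF G])
    show "hub I Y Z" by fact
  qed
  then show "decay I P \<theta> X Y Z" by (rule decay_swap)
next
  show "game I P \<theta> X Y Z" by fact
qed simp

section \<open>From the bipartite graphs to the final bound\<close>

lemma conn_of_bip_connected:
  assumes bip: "bip_connected E" and E: "\<And>x y. E x y \<longleftrightarrow> (\<exists>i\<in>J. X i = x \<and> Y i = y)"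
  shows "conn J X Y"
  unfolding conn_def
proof (intro ballI)
  fix i j assume ij: "i \<in> J" "j \<in> J"
  define inc where "inc k v \<longleftrightarrow> k \<in> J \<and> (case v of Inl x \<Rightarrow> X k = x | Inr y \<Rightarrow> Y k = y)" for k v
  have link: "(k, l) \<in> linked J X Y" if "inc k v" "inc l v" for k l v
    using that by (auto simp: inc_def linked_def split: sum.splits)
  have "(bip_adj E)\<^sup>*\<^sup>* (Inl (X i)) (Inl (X j))" using bip by (simp add: bip_connected_def)
  \<comment> \<open>Invariant along the vertex path: every edge at the current vertex is reachable
    from \<open>i\<close>.\<close>
  then have "\<forall>l. inc l (Inl (X j)) \<longrightarrow> (i, l) \<in> (linked J X Y)\<^sup>*"
  proof (induction rule: rtranclp_induct)
    case base
    have "inc i (Inl (X i))" using ij by (simp add: inc_def)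
    then show ?case using link by blast
  next
    case (step v v')
    obtain k where k: "inc k v" "inc k v'"
      using step.hyps(2) by (auto simp: bip_adj_def inc_def E split: sum.splits)
    then have "(i, k) \<in> (linked J X Y)\<^sup>*" using step.IH by blast
    then show ?case using link[OF k(2)] by (meson rtrancl_into_rtrancl)
  qed
  moreover have "inc j (Inl (X j))" using ij by (simp add: inc_def)
  ultimately show "(i, j) \<in> (linked J X Y)\<^sup>*" by blast
qed

lemma inj_to_nat_exists: "\<exists>f :: 'a::finite \<Rightarrow> nat. inj f"
  using finite_imp_inj_to_nat_seg[of "UNIV :: 'a set"] by auto

theorem theorem2p3:
  fixes \<mu> :: "'a::finite \<times> 'b::finite \<times> 'c::finite \<Rightarrow> real"
    and T :: "'a \<Rightarrow> 'b \<Rightarrow> 'c \<Rightarrow> complex"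
  assumes "is_distribution \<mu>"
    and "pairwise_connected \<mu>"
    and "\<forall>x y z. (x, y, z) \<in> supp \<mu> \<longrightarrow> norm (T x y z) \<le> 1"
    and "nonembeddable_disk \<mu> T"
  shows "\<exists>c>0. \<forall>n F G H.
           (\<forall>xs. length xs = n \<longrightarrow> norm (F xs) \<le> 1) \<longrightarrow>
           (\<forall>ys. length ys = n \<longrightarrow> norm (G ys) \<le> 1) \<longrightarrow>
           (\<forall>zs. length zs = n \<longrightarrow> norm (H zs) \<le> 1) \<longrightarrow>
           norm (corr \<mu> T n F G H) \<le> 2 powr (- c * real n)"
proof -
  define J where "J = supp \<mu>"
  define \<theta> where "\<theta> = (\<lambda>(x, y, z). T x y z)"
  define X :: "'a \<times> 'b \<times> 'c \<Rightarrow> 'a" where "X = fst"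
  define Y :: "'a \<times> 'b \<times> 'c \<Rightarrow> 'b" where "Y = fst \<circ> snd"
  define Z :: "'a \<times> 'b \<times> 'c \<Rightarrow> 'c" where "Z = snd \<circ> snd"
  have pos: "\<mu> t > 0" if "t \<in> J" for t using that by (simp add: J_def supp_def)
  have zero: "\<mu> t = 0" if "t \<notin> J" for t
  proof -
    have "\<mu> t \<ge> 0" using assms(1) unfolding is_distribution_def by blast
    then show ?thesis using that by (simp add: J_def supp_def)
  qed
  have "sum \<mu> J = sum \<mu> UNIV" by (rule sum.mono_neutral_left) (use zero in auto)
  then have P: "prob_on J \<mu>" using pos assms(1) by (simp add: prob_on_def is_distribution_def)
  have th1: "norm (\<theta> t) \<le> 1" if "t \<in> J" for t using that assms(3) by (auto simp: J_def \<theta>_def split: prod.splits)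
  have "decay J \<mu> \<theta> X Y Z"
  proof (cases "\<forall>t\<in>J. norm (\<theta> t) = 1")
    case False
    then obtain s where s: "s \<in> J" "norm (\<theta> s) < 1" using th1 by (meson order.order_iff_strict)
    \<comment> \<open>Here the triangle inequality suffices: the mean of the norms of
      \<open>\<theta>\<close> is below 1 and is raised to the power \<open>n\<close>.\<close>
    let ?\<rho> = "\<Sum>t\<in>J. \<mu> t * norm (\<theta> t)"
    have "?\<rho> < sum \<mu> J"
    proof (rule sum_strict_mono_ex1)
      show "finite J" using P by (simp add: prob_on_def)
      show "\<forall>t\<in>J. \<mu> t * norm (\<theta> t) \<le> \<mu> t" using th1 pos by (simp add: mult_left_le less_imp_le)
      show "\<exists>t\<in>J. \<mu> t * norm (\<theta> t) < \<mu> t" using s pos[OF s(1)] by (intro bexI[of _ s]) simp_all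
    qed
    then have \<rho>: "?\<rho> < 1" using P by (simp add: prob_on_def)
    have \<rho>': "0 \<le> ?\<rho>"
      by (intro sum_nonneg mult_nonneg_nonneg norm_ge_zero less_imp_le[OF pos])
    have "norm (gcorr J \<mu> \<theta> X Y Z n F G H) ^ 1 \<le> ?\<rho> ^ n"
      if bd: "bounded1 F" "bounded1 G" "bounded1 H" for n F G H
    proof -
      have "norm (gcorr J \<mu> \<theta> X Y Z n F G H) \<le> (\<Sum>l\<in>tup n J. lprod (\<lambda>t. \<mu> t * norm (\<theta> t)) l)"
        unfolding gcorr_def
      proof (rule sum_norm_le)
        fix l assume l: "l \<in> tup n J"
        have "norm (F (map X l)) * norm (G (map Y l)) * norm (H (map Z l)) \<le> 1"
          using bd by (intro mult_le_one mult_nonneg_nonneg) (auto simp: bounded1_def)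
        moreover have "lprod \<mu> l * lprod (\<lambda>t. norm (\<theta> t)) l \<ge> 0"
          using l pos by (intro mult_nonneg_nonneg prod_list_nonneg) (auto simp: tup_def less_imp_le)
        moreover have "\<bar>lprod \<mu> l\<bar> = lprod \<mu> l"
          using l pos by (intro abs_of_nonneg prod_list_nonneg) (auto simp: tup_def less_imp_le)
        ultimately have "lprod \<mu> l * lprod (\<lambda>t. norm (\<theta> t)) l * (norm (F (map X l)) * norm (G (map Y l)) * norm (H (map Z l)))
            \<le> lprod \<mu> l * lprod (\<lambda>t. norm (\<theta> t)) l" and "\<bar>lprod \<mu> l\<bar> = lprod \<mu> l"
          by (simp_all add: mult_left_le)
        then show "norm (of_real (lprod \<mu> l) * (lprod \<theta> l * F (map X l) * G (map Y l) * H (map Z l)))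
            \<le> lprod (\<lambda>t. \<mu> t * norm (\<theta> t)) l"
          by (simp only: norm_mult norm_of_real norm_lprod lprod_mult mult.assoc)
      qed
      then show ?thesis by (simp add: sum_tup_lprod)
    qed
    then show ?thesis unfolding decay_def using \<rho> \<rho>' zero_less_one by blast
  next
    case True
    have conn: "conn J X Y" "conn J Y Z" "conn J X Z"
      using assms(2) unfolding pairwise_connected_def
      by (auto elim!: conn_of_bip_connected simp: J_def X_def Y_def Z_def Bex_def)
    have "\<not> embeddable J \<theta> X Y Z"
    proof
      assume "embeddable J \<theta> X Y Z"
      then obtain A B C where ABC: "\<forall>x. norm (A x) = 1" "\<forall>y. norm (B y) = 1" "\<forall>z. norm (C z) = 1"
        "\<forall>t\<in>J. A (X t) * B (Y t) * C (Z t) * \<theta> t = 1" unfolding embeddable_def by blast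
      have "A x * B y * C z * T x y z = 1" if "(x, y, z) \<in> supp \<mu>" for x y z
        using ABC(4) that by (force simp: J_def X_def Y_def Z_def \<theta>_def)
      then show False using assms(4) ABC(1-3) unfolding nonembeddable_disk_def by (metis order_refl)
    qed
    then have G: "game J \<mu> \<theta> X Y Z" using P True conn by (simp add: game_def)
    obtain f :: "'a \<times> 'b \<times> 'c \<Rightarrow> nat" where f: "inj f" using inj_to_nat_exists by blast
    obtain a :: "'a \<Rightarrow> nat" where a: "inj a" using inj_to_nat_exists by blast
    obtain b :: "'b \<Rightarrow> nat" where b: "inj b" using inj_to_nat_exists by blast
    obtain c :: "'c \<Rightarrow> nat" where c: "inj c" using inj_to_nat_exists by blast
    have "decay (f ` J) (\<mu> \<circ> inv f) (\<theta> \<circ> inv f) (a \<circ> X \<circ> inv f) (b \<circ> Y \<circ> inv f) (c \<circ> Z \<circ> inv f)"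
      by (rule game_decay[OF game_relabel[OF G f a b c]])
    then show ?thesis
    proof (rule decay_relabel[rotated -1, where f = f and a = a and b = b and c = c])
      show "bij_betw f J (f ` J)" by (rule bij_betw_imageI) (auto intro: inj_on_subset[OF f])
    qed (use f a b c in auto)
  qed
  then obtain \<rho>0 M where \<rho>0: "0 \<le> \<rho>0" "\<rho>0 < 1" "M > (0::nat)" and
    B: "\<And>n F G H. bounded1 F \<Longrightarrow> bounded1 G \<Longrightarrow> bounded1 H \<Longrightarrow> norm (gcorr J \<mu> \<theta> X Y Z n F G H) ^ M \<le> \<rho>0 ^ n"
    unfolding decay_def by blast
  \<comment> \<open>The lower bound 1/2 keeps the logarithm below meaningful when
    \<open>\<rho>0\<close> is 0.\<close>
  define \<rho> where "\<rho> = max \<rho>0 (1/2)"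
  have \<rho>: "0 < \<rho>" "\<rho> < 1" "\<rho>0 \<le> \<rho>" using \<rho>0 by (auto simp: \<rho>_def)
  \<comment> \<open>Chosen so that \<open>2 powr (- c * M)\<close> equals
    \<open>\<rho>\<close>.\<close>
  define c where "c = - log 2 \<rho> / real M"
  have "c > 0" using \<rho> \<rho>0(3) by (simp add: c_def divide_neg_pos)
  moreover have "norm (corr \<mu> T n F G H) \<le> 2 powr (- c * real n)"
    if F: "\<forall>xs. length xs = n \<longrightarrow> norm (F xs) \<le> 1" and G: "\<forall>ys. length ys = n \<longrightarrow> norm (G ys) \<le> 1"
      and H: "\<forall>zs. length zs = n \<longrightarrow> norm (H zs) \<le> 1" for n F G H
  proof -
    \<comment> \<open>The functions are bounded only on words of length \<open>n\<close>; cutting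
      them off elsewhere makes them bounded everywhere and leaves the sum unchanged.\<close>
    let ?F = "\<lambda>xs. if length xs = n then F xs else 0" and ?G = "\<lambda>xs. if length xs = n then G xs else 0"
      and ?H = "\<lambda>xs. if length xs = n then H xs else 0"
    have bd: "bounded1 ?F" "bounded1 ?G" "bounded1 ?H" using F G H by (auto simp: bounded1_def)
    have "corr \<mu> T n F G H = gcorr J \<mu> \<theta> X Y Z n ?F ?G ?H"
      unfolding corr_def gcorr_def
    proof (rule sum.mono_neutral_cong_right)
      show "finite {w :: ('a \<times> 'b \<times> 'c) list. length w = n}"
        using finite_lists_length_eq[of "UNIV :: ('a \<times> 'b \<times> 'c) set" n] by simp
      show "tup n J \<subseteq> {w. length w = n}" by (auto simp: tup_def)
      show "\<forall>w\<in>{w. length w = n} - tup n J. complex_of_real (\<Prod>t\<leftarrow>w. \<mu> t) *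
        (F (map fst w) * G (map (fst \<circ> snd) w) * H (map (snd \<circ> snd) w) * (\<Prod>(x, y, z)\<leftarrow>w. T x y z)) = 0"
      proof
        fix w assume "w \<in> {w. length w = n} - tup n J"
        then obtain t where "t \<in> set w" "t \<notin> J" by (auto simp: tup_def)
        then have "0 \<in> set (map \<mu> w)" using zero[of t] by (simp add: image_iff) metis
        then have "(\<Prod>t\<leftarrow>w. \<mu> t) = 0" by (simp only: prod_list_zero_iff)
        then show "complex_of_real (\<Prod>t\<leftarrow>w. \<mu> t) *
        (F (map fst w) * G (map (fst \<circ> snd) w) * H (map (snd \<circ> snd) w) * (\<Prod>(x, y, z)\<leftarrow>w. T x y z)) = 0"
          by (simp only: of_real_0 mult_zero_left)
      qed
      fix w assume "w \<in> tup n J"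
      then have "length w = n" by (simp add: tup_def)
      then show "complex_of_real (\<Prod>t\<leftarrow>w. \<mu> t) *
        (F (map fst w) * G (map (fst \<circ> snd) w) * H (map (snd \<circ> snd) w) * (\<Prod>(x, y, z)\<leftarrow>w. T x y z))
        = of_real (lprod \<mu> w) * (lprod \<theta> w * ?F (map X w) * ?G (map Y w) * ?H (map Z w))"
        by (simp add: X_def Y_def Z_def \<theta>_def ac_simps)
    qed
    then have "norm (corr \<mu> T n F G H) ^ M \<le> \<rho>0 ^ n" using B[OF bd] by (simp only:)
    also have "\<dots> \<le> \<rho> ^ n" using \<rho> \<rho>0 by (intro power_mono)
    also have "\<rho> ^ n = (2 powr (- c * real n)) ^ M"
    proof -
      have "(2 powr (- c * real n)) ^ M = 2 powr (log 2 \<rho> * real n)"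
        using \<rho>0(3) by (simp add: c_def powr_power)
      also have "\<dots> = (2 powr log 2 \<rho>) powr real n" by (simp add: powr_powr)
      also have "\<dots> = \<rho> ^ n" using \<rho> by (simp add: powr_realpow)
      finally show ?thesis by simp
    qed
    finally show ?thesis using \<rho>0(3) by (subst (asm) power_mono_iff) auto
  qed
  ultimately show ?thesis by blast
qed

end
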